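(* Suppose $Q\succeq0$, $R\succ0$, $W\succeq0$, $V\succ0$, $(A,W^{1/2})$ and $(A,B)$ are controllable, and $(Q^{1/2},A)$ and $(C,A)$ are observable. Then the LQG policy optimization problem of minimizing $J_{\mathtt{LQG},n}(\mathsf K)=\|\mathbf{T}_{zd}(\mathsf K,s)\|_{\mathcal{H}_2}$ over $\mathsf K\in\mathcal{C}_{n,0}$ is equivalent to a convex problem in the sense that $$\inf_{\mathsf K\in\mathcal{C}_{n,0}}J_{\mathtt{LQG},n}(\mathsf K)=\inf_{(\gamma,\Lambda,X,Y,\Gamma)\in\mathcal{F}_{\mathtt{LQG}}}\gamma.$$ Furthermore, if a non-degenerate policy $\mathsf K\in\mathcal{C}_{n,0}$ is a stationary point, i.e. $\nabla J_{\mathtt{LQG},n}(\mathsf K)=0$, then it is globally optimal, i.e. it minimizes $J_{\mathtt{LQG},n}$ over $\mathcal{C}_{n,0}$.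
   Context: Data: $A\in\mathbb{R}^{n\times n}$, $B\in\mathbb{R}^{n\times m}$, $C\in\mathbb{R}^{p\times n}$, symmetric $Q,W\in\mathbb{S}^n$, $R\in\mathbb{S}^m$, $V\in\mathbb{S}^p$. $\mathrm{GL}_n$ is the set of invertible real $n\times n$ matrices; $\mathbb{S}^k_+$, $\mathbb{S}^k_{++}$ are the positive semidefinite / definite matrices. $B_1=[W^{1/2}\ \ 0_{n\times p}]$, $B_2=B$, $C_1=\begin{bmatrix}Q^{1/2}\\ 0_{m\times n}\end{bmatrix}$, $C_2=C$, $D_{12}=\begin{bmatrix}0_{n\times m}\\ R^{1/2}\end{bmatrix}$, $D_{21}=[0_{p\times n}\ \ V^{1/2}]$. Policies are $\mathsf{K}=\begin{bmatrix}D_{\mathsf K}&C_{\mathsf K}\\ B_{\mathsf K}&A_{\mathsf K}\end{bmatrix}\in\mathbb{R}^{(m+n)\times(p+n)}$ with $D_{\mathsf K}\in\mathbb{R}^{m\times p}$, and $A_{\mathrm{cl}}(\mathsf K)=\begin{bmatrix}A+BD_{\mathsf K}C&BC_{\mathsf K}\\ B_{\mathsf K}C&A_{\mathsf K}\end{bmatrix}$, $B_{\mathrm{cl}}(\mathsf K)=\begin{bmatrix}W^{1/2}&BD_{\mathsf K}V^{1/2}\\ 0&B_{\mathsf K}V^{1/2}\end{bmatrix}$, $C_{\mathrm{cl}}(\mathsf K)=\begin{bmatrix}Q^{1/2}&0\\ R^{1/2}D_{\mathsf K}C&R^{1/2}C_{\mathsf K}\end{bmatrix}$, $D_{\mathrm{cl}}(\mathsf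 K)=\begin{bmatrix}0&0\\ 0&R^{1/2}D_{\mathsf K}V^{1/2}\end{bmatrix}$. $\mathcal{V}_{n,0}$ is the linear space of $\mathsf K$ with $D_{\mathsf K}=0$; $\mathcal{C}_{n,0}=\{\mathsf K\in\mathcal{V}_{n,0}: A_{\mathrm{cl}}(\mathsf K)\text{ is Hurwitz stable}\}$, an open subset of $\mathcal{V}_{n,0}$ (gradients are taken in $\mathcal{V}_{n,0}$). $\mathbf{T}_{zd}(\mathsf K,s)=C_{\mathrm{cl}}(\mathsf K)(sI-A_{\mathrm{cl}}(\mathsf K))^{-1}B_{\mathrm{cl}}(\mathsf K)+D_{\mathrm{cl}}(\mathsf K)$; $\|\mathbf{T}\|_{\mathcal{H}_2}^2=\frac1{2\pi}\int_{-\infty}^\infty\operatorname{tr}(\mathbf{T}(j\omega)^{\mathsf H}\mathbf{T}(j\omega))d\omega$. For a $2n\times2n$ matrix $P$, $P_{12}$ denotes its upper-right $n\times n$ block. $\mathcal{L}_{\mathtt{LQG}}$ is the set of $(\mathsf K,\gamma,P,\Gamma)$ with $\mathsf K\in\mathcal{V}_{n,0}$, $\gamma\in\mathbb{R}$, $P\in\mathbb{S}^{2n}_{++}$, $P_{12}\in\mathrm{GL}_n$, $\Gamma\in\mathbb{S}^{n+m}_+$, $$\begin{bmatrix}A_{\mathrm{cl}}(\mathsf K)^{\mathsf T}P+PA_{\mathrm{cl}}(\mathsf K)&PB_{\mathrm{cl}}(\mathsf K)\\ B_{\mathrm{cl}}(\mathsf K)^{\mathsf T}P&-\gamma I\end{bmatrix}\preceq0,\quad\begin{bmatrix}P&C_{\mathrm{cl}}(\mathsf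 K)^{\mathsf T}\\ C_{\mathrm{cl}}(\mathsf K)&\Gamma\end{bmatrix}\succeq0,\quad\operatorname{tr}(\Gamma)\le\gamma.$$ A policy $\mathsf K\in\mathcal{C}_{n,0}$ is non-degenerate (for LQG) if there exist $P\in\mathbb{S}^{2n}_{++}$ with $P_{12}\in\mathrm{GL}_n$ and $\Gamma$ such that $(\mathsf K,J_{\mathtt{LQG},n}(\mathsf K),P,\Gamma)\in\mathcal{L}_{\mathtt{LQG}}$. $\mathcal{F}_{\mathtt{LQG}}$ is the convex set of $(\gamma,\Lambda,X,Y,\Gamma)$ with $\gamma\in\mathbb{R}$, $\Lambda=\begin{bmatrix}0&F\\ H&M\end{bmatrix}\in\mathcal{V}_{n,0}$, $\begin{bmatrix}X&I\\ I&Y\end{bmatrix}\in\mathbb{S}^{2n}_{++}$ ($X,Y\in\mathbb{S}^n$), $\Gamma\in\mathbb{S}^{n+m}_+$, $\operatorname{tr}(\Gamma)\le\gamma$, and ($*$ denotes symmetric completion) $$\begin{bmatrix}AX+B_2F+(AX+B_2F)^{\mathsf T}&M^{\mathsf T}+A&B_1\\ *&YA+HC_2+(YA+HC_2)^{\mathsf T}&YB_1+HD_{21}\\ *&*&-\gamma I\end{bmatrix}\preceq0,\quad\begin{bmatrix}X&I&(C_1X+D_{12}F)^{\mathsf T}\\ *&Y&C_1^{\mathsf T}\\ *&*&\Gamma\end{bmatrix}\succeq0.$$ *)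

theory Defs
  imports "HOL-Analysis.Analysis"
begin

section \<open>Block matrices\<close>

text \<open>Block rows and block columns are indexed by sum types, the \<^const>\<open>Inl\<close> indices coming first:
  an \<open>(m + n) \<times> (p + n)\<close> matrix has type \<open>real^('p + 'n)^('m + 'n)\<close>.\<close>

definition hcat :: "'a^'p^'r \<Rightarrow> 'a^'q^'r \<Rightarrow> 'a^('p::finite + 'q::finite)^'r::finite" where
  "hcat M N = (\<chi> i j. case j of Inl k \<Rightarrow> M $ i $ k | Inr k \<Rightarrow> N $ i $ k)"

definition vcat :: "'a^'c^'p \<Rightarrow> 'a^'c^'q \<Rightarrow> 'a^'c::finite^('p::finite + 'q::finite)" where
  "vcat M N = (\<chi> i. case i of Inl k \<Rightarrow> M $ k | Inr k \<Rightarrow> N $ k)"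

definition block2 ::
  "'a^'p^'r \<Rightarrow> 'a^'q^'r \<Rightarrow> 'a^'p^'s \<Rightarrow> 'a^'q^'s \<Rightarrow>
    'a^('p::finite + 'q::finite)^('r::finite + 's::finite)" where
  "block2 M11 M12 M21 M22 = vcat (hcat M11 M12) (hcat M21 M22)"

definition blk11 :: "'a^('p::finite + 'q::finite)^('r::finite + 's::finite) \<Rightarrow> 'a^'p^'r" where
  "blk11 M = (\<chi> i j. M $ Inl i $ Inl j)"

definition blk12 :: "'a^('p::finite + 'q::finite)^('r::finite + 's::finite) \<Rightarrow> 'a^'q^'r" where
  "blk12 M = (\<chi> i j. M $ Inl i $ Inr j)"

definition blk21 :: "'a^('p::finite + 'q::finite)^('r::finite + 's::finite) \<Rightarrow> 'a^'p^'s" where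
  "blk21 M = (\<chi> i j. M $ Inr i $ Inl j)"

definition blk22 :: "'a^('p::finite + 'q::finite)^('r::finite + 's::finite) \<Rightarrow> 'a^'q^'s" where
  "blk22 M = (\<chi> i j. M $ Inr i $ Inr j)"

section \<open>Semidefinite matrices and matrix square roots\<close>

definition psd :: "real^'n^'n \<Rightarrow> bool" where
  "psd M \<longleftrightarrow> transpose M = M \<and> (\<forall>x. 0 \<le> x \<bullet> (M *v x))"

definition pd :: "real^'n^'n \<Rightarrow> bool" where
  "pd M \<longleftrightarrow> transpose M = M \<and> (\<forall>x. x \<noteq> 0 \<longrightarrow> 0 < x \<bullet> (M *v x))"

definition nsd :: "real^'n^'n \<Rightarrow> bool" where
  "nsd M \<longleftrightarrow> psd (- M)"

definition matrix_sqrt :: "real^'n^'n \<Rightarrow> real^'n^'n" where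
  "matrix_sqrt M = (THE S. psd S \<and> S ** S = M)"

section \<open>Linear systems\<close>

definition cmat :: "real^'c^'r \<Rightarrow> complex^'c^'r" where
  "cmat M = map_matrix complex_of_real M"

definition hurwitz :: "real^'n^'n \<Rightarrow> bool" where
  "hurwitz M \<longleftrightarrow> (\<forall>(z::complex) v. v \<noteq> 0 \<and> cmat M *v v = z *s v \<longrightarrow> Re z < 0)"

text \<open>Full rank of the controllability matrix \<open>[B, AB, \<dots>, A\<^sup>n\<^sup>-\<^sup>1B]\<close>, respectively of the
  observability matrix with block rows \<open>C, CA, \<dots>, CA\<^sup>n\<^sup>-\<^sup>1\<close>. The iterates are spelled out because
  \<open>^\<close> on matrices is the componentwise power.\<close>

definition controllable :: "real^'n^'n \<Rightarrow> real^'k^'n \<Rightarrow> bool" where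
  "controllable A B \<longleftrightarrow>
     dim (\<Union>k<CARD('n). columns (((\<lambda>M. A ** M) ^^ k) B)) = CARD('n)"

definition observable :: "real^'n^'k \<Rightarrow> real^'n^'n \<Rightarrow> bool" where
  "observable C A \<longleftrightarrow>
     dim (\<Union>k<CARD('n). rows (((\<lambda>M. M ** A) ^^ k) C)) = CARD('n)"

definition conj_transpose :: "complex^'c^'r \<Rightarrow> complex^'r^'c" where
  "conj_transpose M = map_matrix cnj (transpose M)"

text \<open>The integral is a Bochner integral; below the norm is only used for stable transfer
  matrices with zero feedthrough, for which the integrand is integrable.\<close>

definition h2_norm :: "(complex \<Rightarrow> complex^'c^'r) \<Rightarrow> real" where
  "h2_norm T = sqrt (1 / (2 * pi) *
     (\<integral>\<omega>. Re (trace (conj_transpose (T (\<i> * complex_of_real \<omega>)) ** T (\<i> * complex_of_real \<omega>))) \<partial>lborel))"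

section \<open>Policies and closed-loop matrices\<close>

text \<open>A policy is \<open>K = [D\<^sub>K, C\<^sub>K; B\<^sub>K, A\<^sub>K]\<close>.\<close>

definition DK :: "real^('p::finite + 'n::finite)^('m::finite + 'n) \<Rightarrow> real^'p^'m" where
  "DK K = blk11 K"

definition CK :: "real^('p::finite + 'n::finite)^('m::finite + 'n) \<Rightarrow> real^'n^'m" where
  "CK K = blk12 K"

definition BK :: "real^('p::finite + 'n::finite)^('m::finite + 'n) \<Rightarrow> real^'p^'n" where
  "BK K = blk21 K"

definition AK :: "real^('p::finite + 'n::finite)^('m::finite + 'n) \<Rightarrow> real^'n^'n" where
  "AK K = blk22 K"

definition Acl :: "real^'n^'n \<Rightarrow> real^'m^'n \<Rightarrow> real^'n^'p \<Rightarrow>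
    real^('p::finite + 'n::finite)^('m::finite + 'n) \<Rightarrow> real^('n + 'n)^('n + 'n)" where
  "Acl A B C K = block2 (A + B ** DK K ** C) (B ** CK K) (BK K ** C) (AK K)"

definition Bcl :: "real^'m^'n \<Rightarrow> real^'n^'n \<Rightarrow> real^'p^'p \<Rightarrow>
    real^('p::finite + 'n::finite)^('m::finite + 'n) \<Rightarrow> real^('n + 'p)^('n + 'n)" where
  "Bcl B W V K =
     block2 (matrix_sqrt W) (B ** DK K ** matrix_sqrt V) 0 (BK K ** matrix_sqrt V)"

definition Ccl :: "real^'n^'p \<Rightarrow> real^'n^'n \<Rightarrow> real^'m^'m \<Rightarrow>
    real^('p::finite + 'n::finite)^('m::finite + 'n) \<Rightarrow> real^('n + 'n)^('n + 'm)" where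
  "Ccl C Q R K =
     block2 (matrix_sqrt Q) 0 (matrix_sqrt R ** DK K ** C) (matrix_sqrt R ** CK K)"

definition Dcl :: "real^'m^'m \<Rightarrow> real^'p^'p \<Rightarrow>
    real^('p::finite + 'n::finite)^('m::finite + 'n) \<Rightarrow> real^('n + 'p)^('n + 'm)" where
  "Dcl R V K = block2 0 0 0 (matrix_sqrt R ** DK K ** matrix_sqrt V)"

definition Tzd :: "real^'n^'n \<Rightarrow> real^'m^'n \<Rightarrow> real^'n^'p \<Rightarrow>
    real^'n^'n \<Rightarrow> real^'m^'m \<Rightarrow> real^'n^'n \<Rightarrow> real^'p^'p \<Rightarrow>
    real^('p::finite + 'n::finite)^('m::finite + 'n) \<Rightarrow> complex \<Rightarrow> complex^('n + 'p)^('n + 'm)" where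
  "Tzd A B C Q R W V K s =
     cmat (Ccl C Q R K) ** matrix_inv (mat s - cmat (Acl A B C K)) ** cmat (Bcl B W V K)
       + cmat (Dcl R V K)"

definition policy_space :: "(real^('p::finite + 'n::finite)^('m::finite + 'n)) set" where
  "policy_space = {K. DK K = 0}"

definition stabilizing :: "real^'n^'n \<Rightarrow> real^'m^'n \<Rightarrow> real^'n^'p \<Rightarrow>
    (real^('p::finite + 'n::finite)^('m::finite + 'n)) set" where
  "stabilizing A B C = {K \<in> policy_space. hurwitz (Acl A B C K)}"

definition J_LQG :: "real^'n^'n \<Rightarrow> real^'m^'n \<Rightarrow> real^'n^'p \<Rightarrow>
    real^'n^'n \<Rightarrow> real^'m^'m \<Rightarrow> real^'n^'n \<Rightarrow> real^'p^'p \<Rightarrow>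
    real^('p::finite + 'n::finite)^('m::finite + 'n) \<Rightarrow> real" where
  "J_LQG A B C Q R W V K = h2_norm (Tzd A B C Q R W V K)"

text \<open>Gradient of \<open>f\<close> at \<open>x\<close> in the linear subspace \<open>S\<close>, for the inner product inherited from the
  ambient space (for matrices, the Frobenius inner product).\<close>

definition has_gradient_in ::
  "('a::real_inner \<Rightarrow> real) \<Rightarrow> 'a \<Rightarrow> 'a \<Rightarrow> 'a set \<Rightarrow> bool" where
  "has_gradient_in f g x S \<longleftrightarrow>
     g \<in> S \<and> (f has_derivative (\<lambda>h. h \<bullet> g)) (at x within S)"

section \<open>The lifted set and non-degenerate policies\<close>

definition L_LQG :: "real^'n^'n \<Rightarrow> real^'m^'n \<Rightarrow> real^'n^'p \<Rightarrow>
    real^'n^'n \<Rightarrow> real^'m^'m \<Rightarrow> real^'n^'n \<Rightarrow> real^'p^'p \<Rightarrow>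
    ((real^('p::finite + 'n::finite)^('m::finite + 'n)) \<times> real \<times>
      (real^('n + 'n)^('n + 'n)) \<times> (real^('n + 'm)^('n + 'm))) set" where
  "L_LQG A B C Q R W V = {(K, \<gamma>, P, \<Gamma>).
     K \<in> policy_space \<and> pd P \<and> invertible (blk12 P) \<and> psd \<Gamma> \<and>
     nsd (block2
       (transpose (Acl A B C K) ** P + P ** Acl A B C K)  (P ** Bcl B W V K)
       (transpose (Bcl B W V K) ** P)                     (- mat \<gamma>)) \<and>
     psd (block2
       P              (transpose (Ccl C Q R K))
       (Ccl C Q R K)  \<Gamma>) \<and>
     trace \<Gamma> \<le> \<gamma>}"

definition nondegenerate :: "real^'n^'n \<Rightarrow> real^'m^'n \<Rightarrow> real^'n^'p \<Rightarrow>
    real^'n^'n \<Rightarrow> real^'m^'m \<Rightarrow> real^'n^'n \<Rightarrow> real^'p^'p \<Rightarrow>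
    real^('p::finite + 'n::finite)^('m::finite + 'n) \<Rightarrow> bool" where
  "nondegenerate A B C Q R W V K \<longleftrightarrow>
     K \<in> stabilizing A B C \<and>
     (\<exists>P \<Gamma>. (K, J_LQG A B C Q R W V K, P, \<Gamma>) \<in> L_LQG A B C Q R W V)"

section \<open>The convex reformulation\<close>

definition B1 :: "real^'n^'n \<Rightarrow> real^('n::finite + 'p::finite)^'n" where
  "B1 W = hcat (matrix_sqrt W) 0"

definition C1 :: "real^'n^'n \<Rightarrow> real^'n^('n::finite + 'm::finite)" where
  "C1 Q = vcat (matrix_sqrt Q) 0"

definition D12 :: "real^'m^'m \<Rightarrow> real^'m^('n::finite + 'm::finite)" where
  "D12 R = vcat 0 (matrix_sqrt R)"

definition D21 :: "real^'p^'p \<Rightarrow> real^('n::finite + 'p::finite)^'p" where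
  "D21 V = hcat 0 (matrix_sqrt V)"

text \<open>Here \<open>\<Lambda> = [0, F; H, M]\<close> has the block format of a policy. The 3-by-3 block matrices are
  written as 2-by-2 block matrices whose leading block is itself a 2-by-2 block matrix.\<close>

definition F_LQG :: "real^'n^'n \<Rightarrow> real^'m^'n \<Rightarrow> real^'n^'p \<Rightarrow>
    real^'n^'n \<Rightarrow> real^'m^'m \<Rightarrow> real^'n^'n \<Rightarrow> real^'p^'p \<Rightarrow>
    (real \<times> (real^('p::finite + 'n::finite)^('m::finite + 'n)) \<times>
      (real^'n^'n) \<times> (real^'n^'n) \<times> (real^('n + 'm)^('n + 'm))) set" where
  "F_LQG A B C Q R W V = {(\<gamma>, \<Lambda>, X, Y, \<Gamma>).
     \<Lambda> \<in> policy_space \<and> transpose X = X \<and> transpose Y = Y \<and>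
     pd (block2 X (mat 1) (mat 1) Y) \<and> psd \<Gamma> \<and> trace \<Gamma> \<le> \<gamma> \<and>
     (let F = blk12 \<Lambda>; H = blk21 \<Lambda>; M = blk22 \<Lambda>;
          S1 = A ** X + B ** F;
          S2 = Y ** A + H ** C;
          N = Y ** B1 W + H ** D21 V;
          Z = C1 Q ** X + D12 R ** F
      in nsd (block2
           (block2
             (S1 + transpose S1)  (transpose M + A)
             (M + transpose A)    (S2 + transpose S2))  (vcat (B1 W) N)
           (hcat (transpose (B1 W)) (transpose N))      (- mat \<gamma>)) \<and>
         psd (block2
           (block2 X (mat 1) (mat 1) Y)  (vcat (transpose Z) (transpose (C1 Q)))
           (hcat Z (C1 Q))               \<Gamma>))}"

end

theory Submission
  imports Defs "HOL-Complex_Analysis.Cauchy_Integral_Theorem"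
begin

text \<open>A bound \<open>\<gamma>\<close> on the H2 norm of a stable system is certified by a positive definite \<open>P\<close> and a
  matrix \<open>\<Gamma>\<close> satisfying two matrix inequalities (\<open>h2_norm_le_if_lmi\<close>, \<open>lmi_if_h2_norm_less\<close>). For the
  closed loop these are not convex in \<open>(K, P)\<close>, but a congruence with a matrix \<open>T\<close> built from
  \<open>P\<^sup>-\<^sup>1\<close> turns them into the affine inequalities defining the convex set, in the new variables
  \<open>\<Lambda>, X, Y\<close> (\<open>closed_loop_transform\<close>). If the off-diagonal block \<open>N\<close> of \<open>P\<close> is invertible, the map can be
  inverted: \<open>K\<close> is an explicit function of \<open>(\<Lambda>, X, Y)\<close> for fixed \<open>N\<close> (\<open>lift_policy_of\<close>,
  \<open>policy_of_lift\<close>).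

  The correspondence is not exact: an optimal certificate may be degenerate, and a point of the convex
  set may lead to a closed loop that is only marginally stable. Both defects disappear after mixing with
  a strictly feasible point (\<open>strict_point_combine\<close>), and such a point exists by controllability
  of \<open>(A, B)\<close> and observability of \<open>(C, A)\<close> (\<open>strict_point_exists\<close>). As the weight of the strict
  point tends to \<open>0\<close>, the two infima are seen to agree (\<open>INF_J_LQG_eq\<close>).

  For a non-degenerate policy \<open>K\<close> the point of the convex set has value exactly \<open>J(K)\<close>. Were \<open>K\<close> not
  optimal, a segment from this point to a strict point of smaller value would reconstruct, with \<open>N\<close> held
  fixed, to a curve of stabilizing policies that starts at \<open>K\<close>, is Lipschitz there, and along which \<open>J\<close>
  decreases at a linear rate. This is impossible at a stationary point
  (\<open>stationary_nondegenerate_optimal\<close>).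

  The facts on the Lyapunov equation and the formula \<open>tr(CLC\<^sup>T)\<close> for the squared H2 norm, \<open>L\<close> being
  the controllability Gramian, all rest on one integral, \<open>\<integral> (i\<omega> - A)\<^sup>-\<^sup>1 d\<omega> = \<pi>I\<close> in the principal value sense for Hurwitz \<open>A\<close>, which
  is computed by Cauchy's theorem (\<open>has_pv_resolvent\<close>).\<close>

text \<open>Products with transposed matrices are kept in the form \<open>transpose M *v x\<close>.\<close>

declare transpose_matrix_vector [simp del] vector_transpose_matrix [simp del]

section \<open>Matrix algebra\<close>

lemma matrix_add_rdistrib: "((A::'a::semiring_1^'n^'m) + B) ** C = A ** C + B ** C"
  by (simp add: matrix_matrix_mult_def vec_eq_iff sum.distrib distrib_right)

lemma matrix_diff_ldistrib: "(A::'a::ring_1^'n^'m) ** (B - C) = A ** B - A ** C"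
  by (simp add: matrix_matrix_mult_def vec_eq_iff sum_subtractf right_diff_distrib)

lemma matrix_diff_rdistrib: "((A::'a::ring_1^'n^'m) - B) ** C = A ** C - B ** C"
  by (simp add: matrix_matrix_mult_def vec_eq_iff sum_subtractf left_diff_distrib)

lemma matrix_minus_left: "(- (A::'a::ring_1^'n^'m)) ** B = - (A ** B)"
  by (simp add: matrix_matrix_mult_def vec_eq_iff sum_negf)

lemma matrix_minus_right: "(A::'a::ring_1^'n^'m) ** (- B) = - (A ** B)"
  by (simp add: matrix_matrix_mult_def vec_eq_iff sum_negf)

lemma matrix_scaleR_left: "(c *\<^sub>R (A::'a::real_algebra_1^'n^'m)) ** B = c *\<^sub>R (A ** B)"
  by (simp add: matrix_matrix_mult_def vec_eq_iff scaleR_sum_right)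

lemma matrix_scaleR_right: "(A::'a::real_algebra_1^'n^'m) ** (c *\<^sub>R B) = c *\<^sub>R (A ** B)"
  by (simp add: matrix_matrix_mult_def vec_eq_iff scaleR_sum_right)

lemma matrix_zero_left [simp]: "(0::'a::semiring_1^'n^'m) ** B = 0"
  by (simp add: matrix_matrix_mult_def vec_eq_iff)

lemma matrix_zero_right [simp]: "(A::'a::semiring_1^'n^'m) ** 0 = 0"
  by (simp add: matrix_matrix_mult_def vec_eq_iff)

lemma transpose_add: "transpose (A + B) = transpose A + transpose B"
  by (simp add: transpose_def vec_eq_iff)

lemma transpose_diff: "transpose (A - B) = transpose A - transpose B"
  by (simp add: transpose_def vec_eq_iff)

lemma transpose_minus: "transpose (- A) = - transpose A"
  by (simp add: transpose_def vec_eq_iff)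

lemma transpose_zero [simp]: "transpose 0 = 0"
  by (simp add: transpose_def vec_eq_iff)

lemmas mat_distribs = matrix_add_ldistrib matrix_add_rdistrib matrix_diff_ldistrib
  matrix_diff_rdistrib matrix_minus_left matrix_minus_right matrix_scaleR_left matrix_scaleR_right

lemmas transpose_distribs = transpose_add transpose_diff transpose_minus transpose_scalar
  matrix_transpose_mul

lemma matrix_vector_minus_left: "(- (A::real^'n^'m)) *v x = - (A *v x)"
  by (simp add: matrix_vector_mult_def vec_eq_iff sum_negf)

lemma inner_transpose: "(transpose M *v x) \<bullet> y = x \<bullet> ((M::real^'n^'m) *v y)"
  by (simp add: dot_lmul_matrix transpose_matrix_vector)

lemma inner_transpose': "y \<bullet> (transpose M *v x) = x \<bullet> ((M::real^'n^'m) *v y)"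
  by (metis inner_commute inner_transpose)

lemma mat_vector: "mat c *v (x::real^'n) = c *\<^sub>R x"
  by (simp add: mat_def matrix_vector_mult_def vec_eq_iff if_distrib [of "\<lambda>u. u * _"] cong: if_cong)

text \<open>Through its bound, this is submultiplicativity of the norm up to a constant.\<close>

lemma bounded_bilinear_matrix_mult:
  "bounded_bilinear (\<lambda>(A::'a::{euclidean_space,real_algebra_1}^'n^'m) (B::'a^'k^'n). A ** B)"
  by (rule bilinear_conv_bounded_bilinear[THEN iffD1])
    (auto simp: bilinear_def linear_iff mat_distribs)

lemma matrix_inv_mult:
  assumes "invertible (A::'a::semiring_1^'n^'n)"
  shows "A ** matrix_inv A = mat 1" "matrix_inv A ** A = mat 1"
proof -
  have "\<exists>A'. A ** A' = mat 1 \<and> A' ** A = mat 1"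
    using assms by (simp add: invertible_def)
  then have "A ** matrix_inv A = mat 1 \<and> matrix_inv A ** A = mat 1"
    unfolding matrix_inv_def by (rule someI_ex)
  then show "A ** matrix_inv A = mat 1" "matrix_inv A ** A = mat 1"
    by auto
qed

lemma matrix_inv_unique:
  assumes "A ** B = mat 1" "B ** (A::'a::semiring_1^'n^'n) = mat 1"
  shows "matrix_inv A = B"
proof -
  have "invertible A" using assms by (auto simp: invertible_def)
  then have "matrix_inv A = matrix_inv A ** (A ** B)"
    using assms by simp
  also have "\<dots> = B"
    using \<open>invertible A\<close> by (simp add: matrix_mul_assoc matrix_inv_mult)
  finally show ?thesis .
qed

lemma matrix_inv_transpose:
  assumes "invertible (A::real^'n^'n)"
  shows "matrix_inv (transpose A) = transpose (matrix_inv A)"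
  by (rule matrix_inv_unique)
    (simp_all add: matrix_inv_mult[OF assms] flip: matrix_transpose_mul)

lemma invertible_if_kernel_trivial:
  fixes A :: "'a::field^'n^'n"
  assumes "\<And>x. A *v x = 0 \<Longrightarrow> x = 0"
  shows "invertible A"
  using assms by (simp add: invertible_left_inverse matrix_left_invertible_ker)

section \<open>Block matrices\<close>

text \<open>The vector with upper part \<open>x\<close> and lower part \<open>y\<close>.\<close>

definition vjoin :: "'a^'p \<Rightarrow> 'a^'q \<Rightarrow> 'a^('p::finite + 'q::finite)" where
  "vjoin x y = (\<chi> i. case i of Inl k \<Rightarrow> x $ k | Inr k \<Rightarrow> y $ k)"

lemma sum_sum_type:
  "(\<Sum>i\<in>UNIV. f (i :: 'p::finite + 'q::finite)) = (\<Sum>k\<in>UNIV. f (Inl k)) + (\<Sum>k\<in>UNIV. f (Inr k))"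
  by (simp add: sum.Plus flip: UNIV_Plus_UNIV)

lemma forall_sum_type: "(\<forall>i::'p + 'q. P i) \<longleftrightarrow> (\<forall>k. P (Inl k)) \<and> (\<forall>k. P (Inr k))"
  using sumE by metis

lemma vjoin_cases: obtains x y where "z = vjoin x y"
proof
  show "z = vjoin (\<chi> k. z $ Inl k) (\<chi> k. z $ Inr k)"
    by (simp add: vjoin_def vec_eq_iff forall_sum_type)
qed

lemma forall_vjoin: "(\<forall>z. P z) \<longleftrightarrow> (\<forall>x y. P (vjoin x y))"
  by (metis vjoin_cases)

lemma vjoin_eq_0_iff: "vjoin x y = 0 \<longleftrightarrow> x = 0 \<and> y = 0"
  by (auto simp: vjoin_def vec_eq_iff forall_sum_type)

lemma inner_vjoin: "vjoin x y \<bullet> vjoin x' y' = x \<bullet> x' + y \<bullet> y'"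
  by (simp add: vjoin_def inner_vec_def sum_sum_type)

lemma block2_vjoin:
  "block2 a b c d *v vjoin x y = vjoin (a *v x + b *v y) (c *v x + d *v (y::'a::semiring_1^_))"
  by (simp add: block2_def vcat_def hcat_def vjoin_def matrix_vector_mult_def vec_eq_iff
      forall_sum_type sum_sum_type)

lemmas block_defs = block2_def vcat_def hcat_def matrix_matrix_mult_def vec_eq_iff
  forall_sum_type sum_sum_type transpose_def mat_def blk11_def blk12_def blk21_def blk22_def

lemma block2_mult:
  "block2 a b c d ** block2 a' b' c' d' = block2 (a ** a' + b ** c') (a ** b' + b ** d')
     (c ** a' + d ** c') (c ** b' + d ** (d'::'a::semiring_1^_^_))"
  by (simp add: block_defs)

lemma mult_hcat: "M ** hcat e f = hcat (M ** e) (M ** (f::'a::semiring_1^_^_))"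
  by (simp add: block_defs)

lemma vcat_mult: "vcat e f ** M = vcat (e ** M) ((f::'a::semiring_1^_^_) ** M)"
  by (simp add: block_defs)

lemma transpose_block2: "transpose (block2 a b c d) = block2 (transpose a) (transpose c) (transpose b) (transpose d)"
  by (simp add: block_defs)

lemma transpose_hcat: "transpose (hcat a b) = vcat (transpose a) (transpose b)"
  by (simp add: block_defs)

lemma transpose_vcat: "transpose (vcat a b) = hcat (transpose a) (transpose b)"
  by (simp add: block_defs)

lemma block2_add: "block2 a b c d + block2 a' b' c' d' = block2 (a + a') (b + b') (c + c') (d + d')"
  by (simp add: block_defs)

lemma block2_minus: "- block2 a b c d = block2 (- a) (- b) (- c) (- d)"
  by (simp add: block_defs)

lemma block2_scaleR: "r *\<^sub>R block2 a b c d = block2 (r *\<^sub>R a) (r *\<^sub>R b) (r *\<^sub>R c) (r *\<^sub>R d)"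
  by (simp add: block_defs)

lemma vcat_add: "vcat a b + vcat a' b' = vcat (a + a') (b + b')"
  by (simp add: block_defs)

lemma hcat_add: "hcat a b + hcat a' b' = hcat (a + a') (b + b')"
  by (simp add: block_defs)

lemma vcat_scaleR: "r *\<^sub>R vcat a b = vcat (r *\<^sub>R a) (r *\<^sub>R b)"
  by (simp add: block_defs)

lemma hcat_scaleR: "r *\<^sub>R hcat a b = hcat (r *\<^sub>R a) (r *\<^sub>R b)"
  by (simp add: block_defs)

lemma vcat_hcat: "vcat (hcat a b) (hcat c d) = block2 a b c d"
  by (simp add: block2_def)

lemma hcat_vcat: "hcat (vcat a c) (vcat b d) = block2 a b c d"
  by (simp add: block_defs)

lemma mat_1_block2: "mat 1 = block2 (mat 1) 0 0 (mat 1)"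
  by (simp add: block_defs)

lemma block2_eq_iff: "block2 a b c d = block2 a' b' c' d' \<longleftrightarrow> a = a' \<and> b = b' \<and> c = c' \<and> d = d'"
  by (auto simp: block_defs)

lemma block2_blk: "block2 (blk11 M) (blk12 M) (blk21 M) (blk22 M) = M"
  by (simp add: block_defs)

lemma blk_block2 [simp]:
  "blk11 (block2 a b c d) = a" "blk12 (block2 a b c d) = b"
  "blk21 (block2 a b c d) = c" "blk22 (block2 a b c d) = d"
  by (simp_all add: block_defs)

lemma blk_add:
  "blk12 (K + L) = blk12 K + blk12 L" "blk21 (K + L) = blk21 K + blk21 L"
  "blk22 (K + L) = blk22 K + blk22 L" "blk11 (K + L) = blk11 K + blk11 L"
  by (simp_all add: block_defs)

lemma blk_scaleR:
  "blk12 (r *\<^sub>R K) = r *\<^sub>R blk12 K" "blk21 (r *\<^sub>R K) = r *\<^sub>R blk21 K"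
  "blk22 (r *\<^sub>R K) = r *\<^sub>R blk22 K" "blk11 (r *\<^sub>R K) = r *\<^sub>R blk11 K"
  by (simp_all add: block_defs)

section \<open>Positive semidefinite and positive definite matrices\<close>

lemma pd_imp_psd: "pd M \<Longrightarrow> psd M"
  unfolding pd_def psd_def by (metis inner_zero_left less_eq_real_def)

lemma psd_add: "psd M \<Longrightarrow> psd N \<Longrightarrow> psd (M + N)"
  by (simp add: psd_def transpose_add matrix_vector_mult_add_rdistrib inner_add_right)

lemma pd_add_psd: "pd M \<Longrightarrow> psd N \<Longrightarrow> pd (M + N)"
  by (simp add: psd_def pd_def transpose_add matrix_vector_mult_add_rdistrib inner_add_right
      add_pos_nonneg)

lemma psd_scaleR: "psd M \<Longrightarrow> 0 \<le> c \<Longrightarrow> psd (c *\<^sub>R M)"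
  by (simp add: psd_def transpose_scalar flip: scaleR_matrix_vector_assoc)

lemma pd_scaleR: "pd M \<Longrightarrow> 0 < c \<Longrightarrow> pd (c *\<^sub>R M)"
  by (simp add: pd_def transpose_scalar flip: scaleR_matrix_vector_assoc)

lemma psd_congruence:
  assumes "psd M" shows "psd (transpose T ** M ** T)"
  unfolding psd_def
proof (intro conjI allI)
  show "transpose (transpose T ** M ** T) = transpose T ** M ** T"
    using assms by (simp add: psd_def matrix_transpose_mul matrix_mul_assoc)
  fix x
  have "x \<bullet> ((transpose T ** M ** T) *v x) = (T *v x) \<bullet> (M *v (T *v x))"
    by (metis inner_commute inner_transpose matrix_vector_mul_assoc)
  then show "0 \<le> x \<bullet> ((transpose T ** M ** T) *v x)"
    using assms by (simp add: psd_def)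
qed

lemma pd_congruence:
  assumes "pd M" and "\<And>x. T *v x = 0 \<Longrightarrow> x = 0" shows "pd (transpose T ** M ** T)"
  unfolding pd_def
proof (intro conjI allI impI)
  show "transpose (transpose T ** M ** T) = transpose T ** M ** T"
    using assms by (simp add: pd_def matrix_transpose_mul matrix_mul_assoc)
  fix x :: "real^'b" assume "x \<noteq> 0"
  have "x \<bullet> ((transpose T ** M ** T) *v x) = (T *v x) \<bullet> (M *v (T *v x))"
    by (metis inner_commute inner_transpose matrix_vector_mul_assoc)
  then show "0 < x \<bullet> ((transpose T ** M ** T) *v x)"
    using assms \<open>x \<noteq> 0\<close> by (metis pd_def)
qed

lemma pd_invertible: "pd M \<Longrightarrow> invertible M"
  by (rule invertible_if_kernel_trivial) (metis inner_zero_right less_irrefl pd_def)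

lemma pd_matrix_inv:
  assumes "pd M" shows "pd (matrix_inv M)"
proof -
  have inv: "invertible M" using assms by (rule pd_invertible)
  have sym: "transpose (matrix_inv M) = matrix_inv M"
    using assms matrix_inv_transpose[OF inv] by (simp add: pd_def)
  have "pd (transpose (matrix_inv M) ** M ** matrix_inv M)"
  proof (rule pd_congruence[OF assms])
    fix x assume "matrix_inv M *v x = 0"
    then have "M *v (matrix_inv M *v x) = 0" by simp
    then show "x = 0" by (simp add: matrix_vector_mul_assoc matrix_inv_mult[OF inv])
  qed
  then show ?thesis by (simp add: sym matrix_inv_mult[OF inv])
qed

lemma trace_psd:
  assumes "psd (M::real^'n^'n)" shows "0 \<le> trace M"
proof -
  have "M $ i $ i = axis i 1 \<bullet> (M *v axis i 1)" for i
    by (simp add: matrix_vector_mult_basis inner_axis' column_def)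
  then show ?thesis
    using assms unfolding trace_def psd_def by (simp add: sum_nonneg)
qed

lemma trace_scaleR: "trace (c *\<^sub>R (M::real^'n^'n)) = c * trace M"
  by (simp add: trace_def sum_distrib_left)

lemma psd_kernel:
  assumes psd: "psd M" and x0: "x \<bullet> (M *v x) = 0"
  shows "M *v x = 0"
proof -
  let ?y = "M *v x"
  have sym: "x \<bullet> (M *v ?y) = ?y \<bullet> ?y"
    using psd by (metis inner_transpose psd_def)
  have *: "2 * t * (?y \<bullet> ?y) \<le> t\<^sup>2 * (?y \<bullet> (M *v ?y))" for t
  proof -
    have "0 \<le> (x - t *\<^sub>R ?y) \<bullet> (M *v (x - t *\<^sub>R ?y))"
      using psd by (simp add: psd_def)
    also have "\<dots> = x \<bullet> ?y - 2 * t * (?y \<bullet> ?y) + t\<^sup>2 * (?y \<bullet> (M *v ?y))"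
      by (simp add: matrix_vector_mult_diff_distrib matrix_vector_mult_scaleR inner_diff_left
          inner_diff_right sym power2_eq_square algebra_simps)
    finally show ?thesis using x0 by simp
  qed
  define a where "a = ?y \<bullet> ?y"
  define b where "b = ?y \<bullet> (M *v ?y)"
  have ab: "2 * t * a \<le> t\<^sup>2 * b" for t using * by (simp add: a_def b_def)
  have b0: "0 \<le> b" using psd by (simp add: b_def psd_def)
  \<comment> \<open>At this value of \<open>t\<close> the quadratic inequality fails unless \<open>a = 0\<close>.\<close>
  define t where "t = a / (b + 1)"
  have a_eq: "a = t * (b + 1)" using b0 by (simp add: t_def)
  have "2 * t * (t * (b + 1)) \<le> t\<^sup>2 * b" using ab[of t] by (simp flip: a_eq)
  then have "t\<^sup>2 * (b + 2) \<le> 0" by (simp add: algebra_simps power2_eq_square)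
  then have "t = 0" using b0 by (smt (verit) mult_pos_pos zero_less_power2)
  then have "a = 0" by (simp add: a_eq)
  then show ?thesis by (simp add: a_def)
qed

lemma pd_coercive:
  assumes "pd (M::real^'n^'n)"
  obtains c where "0 < c" "\<And>x. c * (x \<bullet> x) \<le> x \<bullet> (M *v x)"
proof -
  let ?S = "sphere (0::real^'n) 1"
  have "continuous_on ?S (\<lambda>x. x \<bullet> (M *v x))"
    by (intro continuous_on_inner continuous_on_id matrix_vector_mult_linear_continuous_on)
  moreover have "compact ?S" "?S \<noteq> {}" by simp_all
  ultimately obtain u where u: "u \<in> ?S" "\<And>x. x \<in> ?S \<Longrightarrow> u \<bullet> (M *v u) \<le> x \<bullet> (M *v x)"
    using continuous_attains_inf[of ?S "\<lambda>x. x \<bullet> (M *v x)"] by blast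
  show thesis
  proof
    have "u \<noteq> 0" using u(1) by auto
    then show "0 < u \<bullet> (M *v u)"
      using assms by (simp add: pd_def)
    fix x
    show "(u \<bullet> (M *v u)) * (x \<bullet> x) \<le> x \<bullet> (M *v x)"
    proof (cases "x = 0")
      case False
      let ?n = "norm x"
      have "u \<bullet> (M *v u) \<le> ((1 / ?n) *\<^sub>R x) \<bullet> (M *v ((1 / ?n) *\<^sub>R x))"
        by (rule u(2)) (simp add: False)
      also have "\<dots> = (x \<bullet> (M *v x)) / (x \<bullet> x)"
        by (simp add: matrix_vector_mult_scaleR dot_square_norm power2_eq_square)
      finally show ?thesis using False by (simp add: field_simps)
    qed simp
  qed
qed

section \<open>The resolvent of a stable matrix on the imaginary axis\<close>

text \<open>The resolvent \<open>R(s) = (sI - A)\<^sup>-\<^sup>1\<close> of a real matrix, as a complex matrix. It is only used for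
  \<open>s\<close> outside the spectrum of \<open>A\<close>.\<close>

definition resolvent :: "real^'n^'n \<Rightarrow> complex \<Rightarrow> complex^'n^'n" where
  "resolvent A s = matrix_inv (mat s - cmat A)"

lemma cmat_nth [simp]: "cmat M $ i $ j = complex_of_real (M $ i $ j)"
  by (simp add: cmat_def)

lemma cmat_mult: "cmat (M ** N) = cmat M ** cmat N"
  by (simp add: vec_eq_iff matrix_matrix_mult_def)

lemma cmat_add: "cmat (M + N) = cmat M + cmat N"
  by (simp add: vec_eq_iff)

lemma cmat_minus: "cmat (- M) = - cmat M"
  by (simp add: vec_eq_iff)

lemma conj_transpose_nth [simp]: "conj_transpose M $ i $ j = cnj (M $ j $ i)"
  by (simp add: conj_transpose_def transpose_def)

lemma conj_transpose_mult: "conj_transpose (M ** N) = conj_transpose N ** conj_transpose M"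
  by (simp add: vec_eq_iff matrix_matrix_mult_def mult.commute)

lemma conj_transpose_cmat: "conj_transpose (cmat M) = cmat (transpose M)"
  by (simp add: vec_eq_iff transpose_def)

lemma conj_transpose_diff: "conj_transpose (M - N) = conj_transpose M - conj_transpose N"
  by (simp add: vec_eq_iff)

lemma conj_transpose_mat: "conj_transpose (mat s) = mat (cnj s)"
  by (simp add: vec_eq_iff mat_def)

lemma mat_mult_nth: "(mat s ** M) $ i $ j = s * (M $ i $ j :: 'a::comm_semiring_1)"
  by (simp add: matrix_matrix_mult_def mat_def if_distrib [of "\<lambda>u. u * _"] cong: if_cong)

lemma mat_mult_commute: "mat s ** M = M ** (mat s :: 'a::comm_semiring_1^'n^'n)"
  by (simp add: vec_eq_iff mat_mult_nth)
    (simp add: matrix_matrix_mult_def mat_def if_distrib [of "\<lambda>u. _ * u"] mult.commute cong: if_cong)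

lemma mat_vector_mult_scale: "mat s *v x = s *s (x :: 'a::comm_semiring_1^'n)"
  by (simp add: vec_eq_iff matrix_vector_mult_def mat_def if_distrib [of "\<lambda>u. u * _"] cong: if_cong)

lemma hurwitz_invertible:
  assumes "hurwitz A" "0 \<le> Re s"
  shows "invertible (mat s - cmat A)"
proof (rule invertible_if_kernel_trivial)
  fix x assume "(mat s - cmat A) *v x = 0"
  then have "cmat A *v x = s *s x"
    by (simp add: matrix_vector_mult_diff_rdistrib mat_vector_mult_scale)
  then show "x = 0"
    using assms by (force simp: hurwitz_def)
qed

lemma det_holomorphic:
  assumes "\<And>i j. (\<lambda>s. M s $ i $ j) holomorphic_on S"
  shows "(\<lambda>s. det (M s)) holomorphic_on S"
  unfolding det_def by (intro holomorphic_intros assms)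

text \<open>By Cramer's rule the entries are quotients of determinants.\<close>

lemma resolvent_holomorphic:
  fixes A :: "real^'n^'n"
  assumes "hurwitz A"
  shows "(\<lambda>s. resolvent A s $ i $ j) holomorphic_on {s. 0 \<le> Re s}"
proof -
  let ?M = "\<lambda>s. mat s - cmat A :: complex^'n^'n"
  \<comment> \<open>\<open>?M s\<close> with column \<open>i\<close> replaced by the \<open>j\<close>-th unit vector, as in Cramer's rule.\<close>
  let ?N = "\<lambda>s. \<chi> k l. if l = i then axis j 1 $ k else ?M s $ k $ l"
  have M: "(\<lambda>s. ?M s $ k $ l) holomorphic_on {s. 0 \<le> Re s}" for k l
    by (cases "k = l") (auto simp: mat_def intro!: holomorphic_intros)
  then have N: "(\<lambda>s. ?N s $ k $ l) holomorphic_on {s. 0 \<le> Re s}" for k l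
    by (cases "l = i") auto
  have nz: "det (?M s) \<noteq> 0" if "0 \<le> Re s" for s
    using hurwitz_invertible[OF assms that] by (simp add: invertible_det_nz)
  have "(\<lambda>s. det (?N s) / det (?M s)) holomorphic_on {s. 0 \<le> Re s}"
    using nz by (intro holomorphic_on_divide det_holomorphic M N) auto
  moreover have "det (?N s) / det (?M s) = resolvent A s $ i $ j" if "s \<in> {s. 0 \<le> Re s}" for s
  proof -
    have "?M s *v (resolvent A s *v axis j 1) = axis j 1"
      using that hurwitz_invertible[OF assms]
      by (simp add: resolvent_def matrix_vector_mul_assoc matrix_inv_mult)
    then have "resolvent A s *v axis j 1
        = (\<chi> k. det (\<chi> i l. if l = k then axis j 1 $ i else ?M s $ i $ l) / det (?M s))"
      using nz[of s] that by (simp add: cramer)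
    then have "(resolvent A s *v axis j 1) $ i = det (?N s) / det (?M s)"
      by simp
    moreover have "(resolvent A s *v axis j 1) $ i = resolvent A s $ i $ j"
      by (simp add: matrix_vector_mult_def axis_def if_distrib [of "\<lambda>u. _ * u"] cong: if_cong)
    ultimately show ?thesis by simp
  qed
  ultimately show ?thesis
    by (metis (no_types, lifting) holomorphic_transform)
qed

lemma norm_mat_mult: "norm (mat s ** (M :: complex^'n^'m)) = cmod s * norm M"
proof -
  have row: "norm ((mat s ** M) $ i) = cmod s * norm (M $ i)" for i
    by (simp add: norm_vec_def mat_mult_nth norm_mult L2_set_right_distrib)
  show ?thesis
    by (simp add: norm_vec_def[of "mat s ** M"] norm_vec_def[of M] row L2_set_right_distrib)
qed

text \<open>\<open>s R(s) = I + A R(s)\<close> shows first that the resolvent is of order \<open>1/|s|\<close> and then that it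
  agrees with \<open>I/s\<close> up to order \<open>1/|s|\<^sup>2\<close>.\<close>

lemma resolvent_decay:
  fixes A :: "real^'n^'n"
  assumes "hurwitz A"
  obtains c \<rho> where "0 < \<rho>" "0 \<le> c"
    "\<And>s i j. \<rho> \<le> cmod s \<Longrightarrow> 0 \<le> Re s \<Longrightarrow>
        cmod (resolvent A s $ i $ j - (if i = j then 1 else 0) / s) \<le> c / (cmod s)\<^sup>2"
proof -
  obtain K where K: "0 < K" "\<And>(M::complex^'n^'n) (N::complex^'n^'n). norm (M ** N) \<le> norm M * norm N * K"
    using bounded_bilinear.pos_bounded[OF bounded_bilinear_matrix_mult] by blast
  define \<alpha> where "\<alpha> = K * norm (cmat A)"
  have "0 \<le> \<alpha>" using K by (simp add: \<alpha>_def)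
  let ?I = "mat 1 :: complex^'n^'n"
  have bound: "cmod (resolvent A s $ i $ j - (if i = j then 1 else 0) / s)
      \<le> 2 * \<alpha> * norm ?I / (cmod s)\<^sup>2"
    if s: "2 * \<alpha> + 1 \<le> cmod s" "0 \<le> Re s" for s i j
  proof -
    let ?R = "resolvent A s"
    have s0: "0 < cmod s" using s \<open>0 \<le> \<alpha>\<close> by linarith
    have "(mat s - cmat A) ** ?R = ?I"
      using hurwitz_invertible[OF assms s(2)] by (simp add: resolvent_def matrix_inv_mult)
    then have eq: "mat s ** ?R = ?I + cmat A ** ?R"
      by (simp add: mat_distribs algebra_simps)
    have AR: "norm (cmat A ** ?R) \<le> \<alpha> * norm ?R"
      using K(2)[of "cmat A" ?R] by (simp add: \<alpha>_def algebra_simps)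
    have "cmod s * norm ?R \<le> norm ?I + \<alpha> * norm ?R"
      using norm_mat_mult[of s ?R] eq AR by (metis norm_triangle_mono order_refl)
    moreover have "2 * \<alpha> * norm ?R \<le> cmod s * norm ?R"
      using s by (intro mult_right_mono) auto
    ultimately have "cmod s * norm ?R \<le> 2 * norm ?I" by linarith
    then have R: "norm ?R \<le> 2 * norm ?I / cmod s" using s0 by (simp add: field_simps)
    have "s * ?R $ i $ j - (if i = j then 1 else 0) = (cmat A ** ?R) $ i $ j"
      using arg_cong[OF eq, of "\<lambda>M. M $ i $ j"] by (simp add: mat_mult_nth) (simp add: mat_def)
    then have "?R $ i $ j - (if i = j then 1 else 0) / s = (cmat A ** ?R) $ i $ j / s"
      using s0 by (simp add: field_simps split: if_splits)
    also have "cmod \<dots> \<le> norm (cmat A ** ?R) / cmod s"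
      using s0 order_trans[OF Finite_Cartesian_Product.norm_nth_le Finite_Cartesian_Product.norm_nth_le]
      unfolding norm_divide by (intro divide_right_mono) auto
    also have "\<dots> \<le> \<alpha> * (2 * norm ?I / cmod s) / cmod s"
      using AR mult_left_mono[OF R \<open>0 \<le> \<alpha>\<close>] s0 by (intro divide_right_mono) auto
    finally show ?thesis by (simp add: power2_eq_square algebra_simps)
  qed
  show thesis
  proof (rule that)
    show "0 < 2 * \<alpha> + 1" "0 \<le> 2 * \<alpha> * norm ?I" using \<open>0 \<le> \<alpha>\<close> by auto
  qed (use bound in auto)
qed

text \<open>\<open>f\<close> has the principal value integral \<open>L\<close>, the limit of its integrals over \<open>[-r, r]\<close>. The
  diagonal entries of the resolvent decay only like \<open>1/|\<omega>|\<close>, so their integrals over the whole line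
  exist only in this sense.\<close>

definition has_pv :: "(real \<Rightarrow> complex) \<Rightarrow> complex \<Rightarrow> bool" where
  "has_pv f L \<longleftrightarrow> (\<forall>r. f integrable_on {-r..r}) \<and>
     ((\<lambda>r. integral {-r..r} f) \<longlongrightarrow> L) at_top"

lemma has_pv_add: "has_pv f L \<Longrightarrow> has_pv g M \<Longrightarrow> has_pv (\<lambda>\<omega>. f \<omega> + g \<omega>) (L + M)"
  unfolding has_pv_def by (auto simp: integral_add intro: integrable_add tendsto_add)

lemma has_pv_cmul: "has_pv f L \<Longrightarrow> has_pv (\<lambda>\<omega>. c * f \<omega>) (c * L)"
  unfolding has_pv_def by (auto intro: integrable_on_mult_right tendsto_mult)

lemma has_pv_mulc: "has_pv f L \<Longrightarrow> has_pv (\<lambda>\<omega>. f \<omega> * c) (L * c)"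
  using has_pv_cmul[of f L c] by (simp add: mult.commute)

lemma has_pv_cnj: "has_pv f L \<Longrightarrow> has_pv (\<lambda>\<omega>. cnj (f \<omega>)) (cnj L)"
  unfolding has_pv_def
  by (auto simp: integrable_on_cnj_iff integral_cnj[symmetric] intro: tendsto_cnj)

lemma has_pv_zero: "has_pv (\<lambda>\<omega>. 0) 0"
  by (simp add: has_pv_def integrable_0)

lemma has_pv_sum: "(\<And>i. i \<in> I \<Longrightarrow> has_pv (f i) (L i)) \<Longrightarrow>
    has_pv (\<lambda>\<omega>. \<Sum>i\<in>I. f i \<omega>) (\<Sum>i\<in>I. L i)"
  by (induction I rule: infinite_finite_induct) (auto intro: has_pv_add has_pv_zero)

lemma has_pv_unique: "has_pv f L \<Longrightarrow> has_pv f M \<Longrightarrow> L = M"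
  unfolding has_pv_def using tendsto_unique trivial_limit_at_top_linorder by blast

lemma has_pv_Re_nonneg:
  assumes "has_pv f L" "\<And>\<omega>. 0 \<le> Re (f \<omega>)" shows "0 \<le> Re L"
proof (rule tendsto_lowerbound)
  show "((\<lambda>r. Re (integral {-r..r} f)) \<longlongrightarrow> Re L) at_top"
    using assms(1) by (auto simp: has_pv_def intro: tendsto_Re)
  show "\<forall>\<^sub>F r in at_top. 0 \<le> Re (integral {-r..r} f)"
  proof (intro always_eventually allI)
    fix r
    have "((\<lambda>\<omega>. Re (f \<omega>)) has_integral Re (integral {-r..r} f)) {-r..r}"
      using assms(1) by (auto simp: has_pv_def intro: has_integral_Re integrable_integral)
    then show "0 \<le> Re (integral {-r..r} f)"
      using assms(2) by (auto intro: has_integral_nonneg)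
  qed
qed simp

text \<open>By Cauchy's theorem on the half disc of radius \<open>r\<close> in the right half plane, where the
  resolvent is holomorphic, the integral over \<open>[-ir, ir]\<close> equals the one over the half circle,
  on which the resolvent is asymptotically \<open>I/s\<close>.\<close>

lemma resolvent_integral_bound:
  fixes A :: "real^'n^'n"
  assumes "hurwitz A" "0 < r" "0 \<le> c"
    and bound: "\<And>s. cmod s = r \<Longrightarrow> 0 \<le> Re s \<Longrightarrow>
        cmod (resolvent A s $ i $ j - (if i = j then 1 else 0) / s) \<le> c / r\<^sup>2"
  shows "cmod (integral {-r..r} (\<lambda>\<omega>. resolvent A (\<i> * of_real \<omega>) $ i $ j)
           - (if i = j then pi else 0)) \<le> c * pi / r"
proof -
  define f where "f = (\<lambda>s. resolvent A s $ i $ j)"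
  define d :: complex where "d = (if i = j then 1 else 0)"
  let ?H = "{s. 0 \<le> Re s}"
  \<comment> \<open>The half circle from \<open>-ir\<close> to \<open>ir\<close>, closed up by the segment back along the imaginary axis.\<close>
  let ?arc = "part_circlepath 0 r (-(pi/2)) (pi/2)"
  let ?line = "linepath (\<i> * of_real r) (- (\<i> * of_real r))"
  have hol: "f holomorphic_on ?H" unfolding f_def by (rule resolvent_holomorphic[OF assms(1)])
  then have cont: "continuous_on ?H f" by (rule holomorphic_on_imp_continuous_on)
  have conv: "convex ?H" by (rule convex_halfspace_Re_ge)
  have arc: "path_image ?arc \<subseteq> ?H"
    using \<open>0 < r\<close> by (auto simp: path_image_part_circlepath' closed_segment_eq_real_ivl
        intro!: mult_nonneg_nonneg cos_ge_zero)
  have arc_norm: "cmod s = r" if "s \<in> path_image ?arc" for s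
    using that \<open>0 < r\<close> in_path_image_part_circlepath[of s 0 r] by auto
  have line: "path_image ?line \<subseteq> ?H"
    unfolding path_image_linepath by (rule closed_segment_subset[OF _ _ conv]) auto
  have ends: "pathfinish ?arc = \<i> * of_real r" "pathstart ?arc = - (\<i> * of_real r)"
  proof -
    have "pathfinish ?arc = of_real r * cis (pi/2)" "pathstart ?arc = of_real r * cis (-(pi/2))"
      by (simp_all add: cis_conv_exp)
    then show "pathfinish ?arc = \<i> * of_real r" "pathstart ?arc = - (\<i> * of_real r)"
      by (simp_all add: complex_eq_iff)
  qed
  have fin: "(f has_contour_integral 0) (?arc +++ ?line)"
  proof (rule Cauchy_theorem_convex_simple[OF hol conv])
    show "path_image (?arc +++ ?line) \<subseteq> ?H"
      using arc line by (rule subset_path_image_join)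
    show "valid_path (?arc +++ ?line)"
      using ends(1) by (intro valid_path_join) simp_all
    show "pathfinish (?arc +++ ?line) = pathstart (?arc +++ ?line)"
      using ends(2) by simp
  qed
  have int_arc: "f contour_integrable_on ?arc"
    by (rule contour_integrable_continuous_part_circlepath) (rule continuous_on_subset[OF cont arc])
  have int_line: "f contour_integrable_on ?line"
    by (rule contour_integrable_continuous_linepath)
      (use continuous_on_subset[OF cont line] in simp)
  have "contour_integral ?line f + contour_integral ?arc f = 0"
    using contour_integral_unique[OF fin] int_arc int_line ends
    by (subst (asm) contour_integral_join) (auto simp: add.commute)
  moreover have "contour_integral (linepath (- (\<i> * of_real r)) (\<i> * of_real r)) f
      = - contour_integral ?line f"
    using continuous_on_subset[OF cont line] by (subst contour_integral_reverse_linepath) auto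
  ultimately have eq: "contour_integral (linepath (- (\<i> * of_real r)) (\<i> * of_real r)) f
      = contour_integral ?arc f"
    by (simp only: add_eq_0_iff)
  have "f contour_integrable_on linepath (- (\<i> * of_real r)) (\<i> * of_real r)"
    by (rule contour_integrable_continuous_linepath)
      (use continuous_on_subset[OF cont line] in \<open>simp add: closed_segment_commute\<close>)
  then have "(f has_contour_integral contour_integral ?arc f)
      (linepath (- (\<i> * of_real r)) (\<i> * of_real r))"
    using eq has_contour_integral_integral by metis
  then have "((\<lambda>x. f (Complex 0 x)) has_integral (- \<i> * contour_integral ?arc f)) {-r..r}"
    using \<open>0 < r\<close> by (subst (asm) has_contour_integral_linepath_same_Re_iff[of _ 0 _ "-r" r]) auto
  then have hi: "((\<lambda>\<omega>. f (\<i> * of_real \<omega>)) has_integral (- \<i> * contour_integral ?arc f)) {-r..r}"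
    by (simp add: Complex_eq)
  have int_d: "((\<lambda>s. d / s) has_contour_integral (\<i> * pi * d)) ?arc"
  proof -
    have cont_d: "continuous_on (path_image ?arc) (\<lambda>s. d / s)"
      using arc_norm[of 0] \<open>0 < r\<close> by (intro continuous_intros) auto
    have "contour_integral ?arc (\<lambda>s. d / s)
        = integral {-(pi/2)..pi/2} (\<lambda>t. d / (0 + r * cis t) * r * \<i> * cis t)"
      by (rule contour_integral_part_circlepath_eq) simp
    also have "\<dots> = integral {-(pi/2)..pi/2} (\<lambda>t. \<i> * d)"
      using \<open>0 < r\<close> by (intro integral_cong) simp
    also have "\<dots> = \<i> * pi * d" by (simp add: scaleR_conv_of_real algebra_simps)
    finally show ?thesis
      using contour_integrable_continuous_part_circlepath[OF cont_d]
      by (metis has_contour_integral_integral)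
  qed
  have "((\<lambda>s. f s - d / s) has_contour_integral (contour_integral ?arc f - \<i> * pi * d)) ?arc"
    by (intro has_contour_integral_diff int_d has_contour_integral_integral int_arc)
  then have "cmod (contour_integral ?arc f - \<i> * pi * d) \<le> c / r\<^sup>2 * r * (pi / 2 - - (pi / 2))"
  proof (rule has_contour_integral_bound_part_circlepath)
    fix s assume s: "s \<in> path_image ?arc"
    show "cmod (f s - d / s) \<le> c / r\<^sup>2"
      unfolding f_def d_def using s arc arc_norm by (intro bound) auto
  qed (use assms in auto)
  also have "\<dots> = c * pi / r" using \<open>0 < r\<close> by (simp add: power2_eq_square)
  finally have "cmod (contour_integral ?arc f - \<i> * pi * d) \<le> c * pi / r" .
  moreover have "- \<i> * contour_integral ?arc f - pi * d = - \<i> * (contour_integral ?arc f - \<i> * pi * d)"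
    by (simp add: algebra_simps)
  then have "cmod (- \<i> * contour_integral ?arc f - pi * d) = cmod (contour_integral ?arc f - \<i> * pi * d)"
    by (simp add: norm_mult)
  ultimately show "cmod (integral {-r..r} (\<lambda>\<omega>. resolvent A (\<i> * of_real \<omega>) $ i $ j)
           - (if i = j then pi else 0)) \<le> c * pi / r"
    using integral_unique[OF hi] by (simp add: f_def d_def split: if_splits)
qed

lemma resolvent_continuous:
  assumes "hurwitz A"
  shows "continuous_on S (\<lambda>\<omega>. resolvent A (\<i> * complex_of_real \<omega>) $ i $ j)"
proof -
  have "continuous_on UNIV ((\<lambda>s. resolvent A s $ i $ j) \<circ> (\<lambda>\<omega>. \<i> * complex_of_real \<omega>))"
    by (intro continuous_on_compose continuous_intros
        continuous_on_subset[OF holomorphic_on_imp_continuous_on[OF resolvent_holomorphic[OF assms]]]) auto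
  then show ?thesis by (auto simp: o_def intro: continuous_on_subset)
qed

text \<open>The entries of the resolvent along the imaginary axis integrate to those of \<open>\<pi>I\<close>.\<close>

lemma has_pv_resolvent:
  fixes A :: "real^'n^'n"
  assumes "hurwitz A"
  shows "has_pv (\<lambda>\<omega>. resolvent A (\<i> * of_real \<omega>) $ i $ j) (if i = j then pi else 0)"
  unfolding has_pv_def
proof (intro conjI allI)
  fix r show "(\<lambda>\<omega>. resolvent A (\<i> * of_real \<omega>) $ i $ j) integrable_on {-r..r}"
    by (intro integrable_continuous_real resolvent_continuous assms)
next
  obtain c \<rho> where c: "0 < \<rho>" "0 \<le> c"
    "\<And>s i j. \<rho> \<le> cmod s \<Longrightarrow> 0 \<le> Re s \<Longrightarrow>
        cmod (resolvent A s $ i $ j - (if i = j then 1 else 0) / s) \<le> c / (cmod s)\<^sup>2"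
    using resolvent_decay[OF assms] by metis
  have lim: "((\<lambda>r. c * pi / r) \<longlongrightarrow> 0) at_top"
    by (rule real_tendsto_divide_at_top[OF tendsto_const filterlim_ident])
  have "\<forall>\<^sub>F r in at_top. norm (integral {-r..r} (\<lambda>\<omega>. resolvent A (\<i> * of_real \<omega>) $ i $ j)
           - (if i = j then pi else 0)) \<le> c * pi / r"
    using eventually_ge_at_top[of \<rho>]
  proof eventually_elim
    case (elim r)
    then show ?case
      using c(1,2) c(3)[of _ i j] by (intro resolvent_integral_bound[OF assms]) auto
  qed
  then show "((\<lambda>r. integral {-r..r} (\<lambda>\<omega>. resolvent A (\<i> * of_real \<omega>) $ i $ j))
      \<longlongrightarrow> (if i = j then pi else 0)) at_top"
    by (rule LIM_zero_cancel[OF Lim_null_comparison[OF _ lim]])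
qed

section \<open>The Lyapunov equation\<close>

text \<open>On the imaginary axis \<open>(i\<omega> - A) X + X (i\<omega> - A)\<^sup>H = S\<close> for a solution of the Lyapunov equation.
  Multiplying by the resolvent from both sides makes the quadratic expression \<open>R S R\<^sup>H\<close> linear in \<open>R\<close>.\<close>

lemma lyapunov_resolvent:
  fixes A :: "real^'n^'n"
  assumes "hurwitz A" and lyap: "A ** X + X ** transpose A = - S"
  defines "R \<equiv> \<lambda>\<omega>. resolvent A (\<i> * of_real \<omega>)"
  shows "R \<omega> ** cmat S ** conj_transpose (R \<omega>)
     = cmat X ** conj_transpose (R \<omega>) + R \<omega> ** cmat X"
proof -
  let ?s = "\<i> * complex_of_real \<omega>"
  let ?M = "mat ?s - cmat A :: complex^'n^'n"
  have inv: "invertible ?M" using assms(1) by (rule hurwitz_invertible) simp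
  have RM: "R \<omega> ** ?M = mat 1" "?M ** R \<omega> = mat 1"
    unfolding R_def resolvent_def by (simp_all add: matrix_inv_mult[OF inv])
  have MR: "conj_transpose ?M ** conj_transpose (R \<omega>) = mat 1"
    by (simp add: RM conj_transpose_mat flip: conj_transpose_mult)
  have "cmat S = - (cmat A ** cmat X + cmat X ** cmat (transpose A))"
    using arg_cong[OF lyap, of cmat] by (simp add: cmat_mult cmat_add cmat_minus)
  also have "\<dots> = ?M ** cmat X + cmat X ** conj_transpose ?M"
    by (simp add: conj_transpose_diff conj_transpose_mat conj_transpose_cmat mat_distribs
        mat_mult_commute[of _ "cmat X"])
      (simp add: mat_distribs vec_eq_iff flip: mat_mult_commute, simp add: mat_mult_nth)
  finally have S: "cmat S = ?M ** cmat X + cmat X ** conj_transpose ?M" .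
  have "R \<omega> ** cmat S ** conj_transpose (R \<omega>)
    = (R \<omega> ** ?M) ** cmat X ** conj_transpose (R \<omega>)
      + R \<omega> ** cmat X ** (conj_transpose ?M ** conj_transpose (R \<omega>))"
    unfolding S matrix_add_ldistrib matrix_add_rdistrib by (simp only: matrix_mul_assoc)
  then show ?thesis by (simp add: RM MR)
qed

text \<open>Every solution of the Lyapunov equation is recovered from its right-hand side by integration along
  the imaginary axis. Uniqueness, symmetry, definiteness and the formula for the H2 norm all follow.\<close>

lemma has_pv_lyapunov:
  fixes A :: "real^'n^'n"
  assumes "hurwitz A" and "A ** X + X ** transpose A = - S"
  defines "R \<equiv> \<lambda>\<omega>. resolvent A (\<i> * of_real \<omega>)"
  shows "has_pv (\<lambda>\<omega>. (R \<omega> ** cmat S ** conj_transpose (R \<omega>)) $ i $ j) (2 * pi * X $ i $ j)"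
proof -
  have R: "has_pv (\<lambda>\<omega>. R \<omega> $ k $ l) (if k = l then pi else 0)" for k l
    unfolding R_def using has_pv_resolvent[OF assms(1), of k l] by (simp split: if_splits)
  have "has_pv (\<lambda>\<omega>. (\<Sum>k\<in>UNIV. of_real (X $ i $ k) * cnj (R \<omega> $ j $ k)) + (\<Sum>k\<in>UNIV. R \<omega> $ i $ k * X $ k $ j))
     ((\<Sum>k\<in>UNIV. of_real (X $ i $ k) * cnj (complex_of_real (if j = k then pi else 0))) + (\<Sum>k\<in>UNIV. complex_of_real (if i = k then pi else 0) * X $ k $ j))"
    by (intro has_pv_add has_pv_sum has_pv_cmul has_pv_mulc has_pv_cnj R)
  moreover have "(R \<omega> ** cmat S ** conj_transpose (R \<omega>)) $ i $ j
      = (\<Sum>k\<in>UNIV. of_real (X $ i $ k) * cnj (R \<omega> $ j $ k)) + (\<Sum>k\<in>UNIV. R \<omega> $ i $ k * X $ k $ j)" for \<omega>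
    unfolding R_def lyapunov_resolvent[OF assms(1,2)] by (simp add: matrix_matrix_mult_def)
  moreover have "(\<Sum>k\<in>UNIV. of_real (X $ i $ k) * cnj (complex_of_real (if j = k then pi else 0)))
      + (\<Sum>k\<in>UNIV. complex_of_real (if i = k then pi else 0) * X $ k $ j) = complex_of_real (2 * pi * X $ i $ j)"
    by (simp add: if_distrib[of "\<lambda>u. u * _"] if_distrib[of "\<lambda>u. _ * u"] if_distrib[of cnj] if_distrib[of of_real] algebra_simps
        cong: if_cong)
  ultimately show ?thesis by simp
qed

lemma lyapunov_unique:
  fixes A :: "real^'n^'n"
  assumes "hurwitz A" and "A ** X + X ** transpose A = 0"
  shows "X = 0"
proof -
  have "X $ i $ j = 0" for i j
  proof -
    have "cmat 0 = (0 :: complex^'n^'n)" by (simp add: vec_eq_iff)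
    then have "has_pv (\<lambda>\<omega>. 0) (2 * pi * X $ i $ j)"
      using has_pv_lyapunov[OF assms(1), of X 0 i j] assms(2) by simp
    from has_pv_unique[OF this has_pv_zero] show ?thesis by simp
  qed
  then show ?thesis by (simp add: vec_eq_iff)
qed

lemma lyapunov_symmetric:
  fixes A :: "real^'n^'n"
  assumes "hurwitz A" and eq: "A ** X + X ** transpose A = - S" and "transpose S = S"
  shows "transpose X = X"
proof -
  have "A ** transpose X + transpose X ** transpose A = - S"
    using arg_cong[OF eq, of transpose] assms(3) by (simp add: transpose_distribs add.commute)
  then have "A ** (X - transpose X) + (X - transpose X) ** transpose A = 0"
    using eq by (simp add: mat_distribs algebra_simps)
  then have "X - transpose X = 0" by (rule lyapunov_unique[OF assms(1)])
  then show ?thesis by simp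
qed

text \<open>Uniqueness gives existence, since \<open>X \<mapsto> A X + X A\<^sup>T\<close> is a linear map on a finite-dimensional space.\<close>

lemma lyapunov_exists:
  fixes A :: "real^'n^'n"
  assumes "hurwitz A"
  obtains X where "A ** X + X ** transpose A = - S"
proof -
  let ?L = "\<lambda>X :: real^'n^'n. A ** X + X ** transpose A"
  have lin: "linear ?L"
    by (auto simp: linear_iff mat_distribs algebra_simps scaleR_add_right)
  have "inj ?L"
    unfolding linear_injective_0[OF lin] using lyapunov_unique[OF assms] by blast
  then have "surj ?L"
    using linear_injective_imp_surjective[OF lin] by simp
  then obtain X where "- S = ?L X" by (rule surjE)
  then show thesis using that[of X] by simp
qed

lemma sum_swap_pairs:
  "(\<Sum>i\<in>I. \<Sum>j\<in>J. \<Sum>l\<in>L. \<Sum>k\<in>K. f i j k l) = (\<Sum>l\<in>L. \<Sum>k\<in>K. \<Sum>i\<in>I. \<Sum>j\<in>J. f i j k l)"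
proof -
  have "(\<Sum>i\<in>I. \<Sum>j\<in>J. \<Sum>l\<in>L. \<Sum>k\<in>K. f i j k l) = (\<Sum>i\<in>I. \<Sum>l\<in>L. \<Sum>j\<in>J. \<Sum>k\<in>K. f i j k l)"
    by (rule sum.cong[OF refl], rule sum.swap)
  also have "\<dots> = (\<Sum>l\<in>L. \<Sum>i\<in>I. \<Sum>j\<in>J. \<Sum>k\<in>K. f i j k l)"
    by (rule sum.swap)
  also have "\<dots> = (\<Sum>l\<in>L. \<Sum>i\<in>I. \<Sum>k\<in>K. \<Sum>j\<in>J. f i j k l)"
    by (rule sum.cong[OF refl], rule sum.cong[OF refl], rule sum.swap)
  also have "\<dots> = (\<Sum>l\<in>L. \<Sum>k\<in>K. \<Sum>i\<in>I. \<Sum>j\<in>J. f i j k l)"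
    by (rule sum.cong[OF refl], rule sum.swap)
  finally show ?thesis .
qed

lemma lyapunov_psd:
  fixes A :: "real^'n^'n"
  assumes "hurwitz A" and eq: "A ** X + X ** transpose A = - S" and "psd S"
  shows "psd X"
  unfolding psd_def
proof (intro conjI allI)
  show "transpose X = X"
    using lyapunov_symmetric[OF assms(1,2)] \<open>psd S\<close> by (simp add: psd_def)
  fix x
  define R where "R = (\<lambda>\<omega>. resolvent A (\<i> * of_real \<omega>))"
  define G where "G = (\<lambda>\<omega>. R \<omega> ** cmat S ** conj_transpose (R \<omega>))"
  have pv: "has_pv (\<lambda>\<omega>. \<Sum>i\<in>UNIV. \<Sum>j\<in>UNIV. of_real (x $ i * x $ j) * G \<omega> $ i $ j)
      (\<Sum>i\<in>UNIV. \<Sum>j\<in>UNIV. of_real (x $ i * x $ j) * of_real (2 * pi * X $ i $ j))"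
    unfolding G_def R_def
    using has_pv_lyapunov[OF assms(1,2)] by (intro has_pv_sum has_pv_cmul) simp
  have "0 \<le> Re (\<Sum>i\<in>UNIV. \<Sum>j\<in>UNIV. of_real (x $ i * x $ j) * G \<omega> $ i $ j)" for \<omega>
  proof -
    \<comment> \<open>The integrand is the Hermitian form of \<open>S\<close> at \<open>x\<^sup>T R\<close>, split into real and imaginary parts.\<close>
    define w where "w k = (\<Sum>i\<in>UNIV. x $ i * R \<omega> $ i $ k)" for k
    define u where "u = (\<chi> k. Re (w k))"
    define v where "v = (\<chi> k. Im (w k))"
    have "(\<Sum>i\<in>UNIV. \<Sum>j\<in>UNIV. of_real (x $ i * x $ j) * G \<omega> $ i $ j)
       = (\<Sum>i\<in>UNIV. \<Sum>j\<in>UNIV. \<Sum>l\<in>UNIV. \<Sum>k\<in>UNIV. (x $ i * R \<omega> $ i $ k) * S $ k $ l * cnj (x $ j * R \<omega> $ j $ l))"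
      by (simp add: G_def matrix_matrix_mult_def sum_distrib_left sum_distrib_right mult_ac)
    also have "\<dots> = (\<Sum>l\<in>UNIV. \<Sum>k\<in>UNIV. \<Sum>i\<in>UNIV. \<Sum>j\<in>UNIV. (x $ i * R \<omega> $ i $ k) * S $ k $ l * cnj (x $ j * R \<omega> $ j $ l))"
      by (rule sum_swap_pairs)
    also have "\<dots> = (\<Sum>l\<in>UNIV. \<Sum>k\<in>UNIV. w k * S $ k $ l * cnj (w l))"
      by (simp add: w_def sum_distrib_left sum_distrib_right mult_ac)
    finally have "Re (\<Sum>i\<in>UNIV. \<Sum>j\<in>UNIV. of_real (x $ i * x $ j) * G \<omega> $ i $ j)
       = (\<Sum>l\<in>UNIV. \<Sum>k\<in>UNIV. (u $ k * S $ k $ l * u $ l + v $ k * S $ k $ l * v $ l))"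
      by (simp add: u_def v_def algebra_simps)
    also have "\<dots> = u \<bullet> (S *v u) + v \<bullet> (S *v v)"
      by (subst sum.swap) (simp add: inner_vec_def matrix_vector_mult_def sum_distrib_left sum.distrib mult_ac)
    finally show ?thesis using \<open>psd S\<close> by (simp add: psd_def)
  qed
  from has_pv_Re_nonneg[OF pv this]
  have "0 \<le> 2 * pi * (\<Sum>i\<in>UNIV. \<Sum>j\<in>UNIV. x $ i * x $ j * X $ i $ j)"
    by (simp add: sum_distrib_left mult_ac)
  also have "(\<Sum>i\<in>UNIV. \<Sum>j\<in>UNIV. x $ i * x $ j * X $ i $ j) = x \<bullet> (X *v x)"
    by (simp add: inner_vec_def matrix_vector_mult_def sum_distrib_left mult_ac)
  finally show "0 \<le> x \<bullet> (X *v x)" using pi_gt_zero by (auto simp: zero_le_mult_iff)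
qed

lemma lyapunov_pd:
  fixes A :: "real^'n^'n"
  assumes "hurwitz A" and eq: "A ** X + X ** transpose A = - S" and "pd S"
  shows "pd X"
proof -
  have psd: "psd X" using lyapunov_psd[OF assms(1,2)] pd_imp_psd[OF assms(3)] by simp
  have "x = 0" if "x \<bullet> (X *v x) = 0" for x
  proof (rule ccontr)
    assume "x \<noteq> 0"
    have Xx: "X *v x = 0" using psd that by (rule psd_kernel)
    have "x \<bullet> ((A ** X + X ** transpose A) *v x) = 0"
      using psd Xx inner_transpose[of X x "transpose A *v x"]
      by (simp add: matrix_vector_mult_add_rdistrib inner_add_right psd_def flip: matrix_vector_mul_assoc)
    then show False
      using \<open>pd S\<close> \<open>x \<noteq> 0\<close> by (force simp: eq matrix_vector_minus_left pd_def)
  qed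
  then show ?thesis using psd by (force simp: pd_def psd_def order.order_iff_strict)
qed

text \<open>A strict Lyapunov inequality certifies stability.\<close>

lemma hurwitz_if_lyapunov:
  fixes A :: "real^'n^'n"
  assumes "pd P" and neg: "\<And>x. x \<noteq> 0 \<Longrightarrow> x \<bullet> (P *v (A *v x)) < 0"
  shows "hurwitz A"
  unfolding hurwitz_def
proof (intro allI impI, elim conjE)
  fix z :: complex and w
  assume "w \<noteq> 0" and ev: "cmat A *v w = z *s w"
  \<comment> \<open>For a complex eigenvector \<open>x + iy\<close> the forms of \<open>PA\<close> at \<open>x\<close> and \<open>y\<close> add up to \<open>Re z\<close> times those of \<open>P\<close>.\<close>
  define x where "x = (\<chi> i. Re (w $ i))"
  define y where "y = (\<chi> i. Im (w $ i))"
  have ev': "(\<Sum>j\<in>UNIV. A $ i $ j * w $ j) = z * w $ i" for i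
    using arg_cong[OF ev, of "\<lambda>v. v $ i"] by (simp add: matrix_vector_mult_def)
  have Ax: "A *v x = Re z *\<^sub>R x - Im z *\<^sub>R y"
    using arg_cong[OF ev', of Re] by (simp add: vec_eq_iff matrix_vector_mult_def x_def y_def)
  have Ay: "A *v y = Im z *\<^sub>R x + Re z *\<^sub>R y"
    using arg_cong[OF ev', of Im] by (simp add: vec_eq_iff matrix_vector_mult_def x_def y_def algebra_simps)
  have xy: "x \<noteq> 0 \<or> y \<noteq> 0"
    using \<open>w \<noteq> 0\<close> by (auto simp: vec_eq_iff x_def y_def complex_eq_iff)
  have sym: "x \<bullet> (P *v y) = y \<bullet> (P *v x)"
    using \<open>pd P\<close> by (metis inner_transpose' pd_def)
  have le: "u \<bullet> (P *v (A *v u)) \<le> 0" "0 \<le> u \<bullet> (P *v u)" for u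
    using neg[of u] \<open>pd P\<close> by (cases "u = 0"; force simp: pd_def)+
  have "x \<bullet> (P *v (A *v x)) + y \<bullet> (P *v (A *v y)) = Re z * (x \<bullet> (P *v x) + y \<bullet> (P *v y))"
    unfolding Ax Ay
    by (simp add: matrix_vector_mult_diff_distrib matrix_vector_right_distrib
        matrix_vector_mult_scaleR inner_diff_right inner_add_right sym algebra_simps)
  moreover have "x \<bullet> (P *v (A *v x)) + y \<bullet> (P *v (A *v y)) < 0"
    using xy neg le(1) by (meson add_neg_nonpos add_nonpos_neg)
  moreover have "0 \<le> x \<bullet> (P *v x) + y \<bullet> (P *v y)"
    using le(2) by (simp add: add_nonneg_nonneg)
  ultimately show "Re z < 0" by (metis mult_less_0_iff not_le)
qed

section \<open>The H2 norm\<close>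

text \<open>For nonnegative continuous functions the Lebesgue integral over the line is the limit of the
  integrals over \<open>[-r, r]\<close>, by monotone convergence.\<close>

lemma nonneg_integral_lborel:
  fixes g :: "real \<Rightarrow> real"
  assumes cont: "continuous_on UNIV g" and nonneg: "\<And>\<omega>. 0 \<le> g \<omega>"
    and lim: "((\<lambda>r. integral {-r..r} g) \<longlongrightarrow> L) at_top"
  shows "integral\<^sup>L lborel g = L"
proof (rule integral_monotone_convergence)
  let ?f = "\<lambda>(n::nat) \<omega>. indicat_real {- real n..real n} \<omega> *\<^sub>R g \<omega>"
  have si: "set_integrable lborel {- real n..real n} g" for n
    by (rule borel_integrable_atLeastAtMost') (rule continuous_on_subset[OF cont], simp)
  show "integrable lborel (?f n)" for n
    using si by (simp add: set_integrable_def)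
  show "AE \<omega> in lborel. mono (\<lambda>n. ?f n \<omega>)"
    using nonneg by (auto simp: mono_def split: split_indicator)
  show "AE \<omega> in lborel. (\<lambda>n. ?f n \<omega>) \<longlonglongrightarrow> g \<omega>"
  proof (intro AE_I2 tendsto_eventually)
    fix \<omega>
    show "\<forall>\<^sub>F n in sequentially. ?f n \<omega> = g \<omega>"
      using eventually_ge_at_top[of "nat \<lceil>\<bar>\<omega>\<bar>\<rceil>"]
    proof eventually_elim
      case (elim n)
      then have "\<bar>\<omega>\<bar> \<le> real n" by linarith
      then show ?case by (simp add: abs_le_iff)
    qed
  qed
  have "(\<lambda>n. integral {- real n..real n} g) \<longlonglongrightarrow> L"
    by (rule filterlim_compose[OF lim filterlim_real_sequentially])
  moreover have "integral\<^sup>L lborel (?f n) = integral {- real n..real n} g" for n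
    using set_borel_integral_eq_integral(2)[OF si] by (simp add: set_lebesgue_integral_def)
  ultimately show "(\<lambda>n. integral\<^sup>L lborel (?f n)) \<longlonglongrightarrow> L" by simp
  show "g \<in> borel_measurable lborel"
    using cont by (simp add: borel_measurable_continuous_onI)
qed

text \<open>The H2 norm in terms of the controllability Gramian \<open>L\<close>.\<close>

lemma h2_norm_eq_gramian:
  fixes A :: "real^'n^'n" and B :: "real^'k^'n" and C :: "real^'n^'l"
  assumes "hurwitz A" and lyap: "A ** L + L ** transpose A = - (B ** transpose B)"
  shows "h2_norm (\<lambda>s. cmat C ** matrix_inv (mat s - cmat A) ** cmat B)
    = sqrt (trace (C ** L ** transpose C))"
proof -
  define R where "R = (\<lambda>\<omega>. resolvent A (\<i> * of_real \<omega>))"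
  define G where "G = (\<lambda>\<omega>. R \<omega> ** cmat (B ** transpose B) ** conj_transpose (R \<omega>))"
  define T where "T = (\<lambda>\<omega>. cmat C ** R \<omega> ** cmat B)"
  define h where "h = (\<lambda>\<omega>. trace (conj_transpose (T \<omega>) ** T \<omega>))"
  have h_eq: "h \<omega> = (\<Sum>k\<in>UNIV. \<Sum>j\<in>UNIV. \<Sum>i\<in>UNIV. of_real (C $ k $ i * C $ k $ j) * G \<omega> $ i $ j)" for \<omega>
  proof -
    have "T \<omega> ** conj_transpose (T \<omega>) = cmat C ** G \<omega> ** cmat (transpose C)"
      by (simp add: T_def G_def conj_transpose_mult conj_transpose_cmat cmat_mult matrix_mul_assoc)
    then have "h \<omega> = trace (cmat C ** G \<omega> ** cmat (transpose C))"
      by (simp add: h_def trace_mul_sym[of "conj_transpose (T \<omega>)"])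
    then show ?thesis
      by (simp add: trace_def matrix_matrix_mult_def transpose_def sum_distrib_right
          sum_distrib_left mult_ac)
  qed
  have h_re: "Re (h \<omega>) = (\<Sum>i\<in>UNIV. \<Sum>j\<in>UNIV. (cmod (T \<omega> $ j $ i))\<^sup>2)" for \<omega>
    by (simp add: h_def trace_def matrix_matrix_mult_def cmod_power2 flip: power2_eq_square)
  have R_cont: "continuous_on UNIV (\<lambda>\<omega>. R \<omega> $ i $ j)" for i j
    unfolding R_def by (rule resolvent_continuous[OF assms(1)])
  have h_cont: "continuous_on UNIV (\<lambda>\<omega>. Re (h \<omega>))"
    unfolding h_re T_def matrix_matrix_mult_def
    by (simp, intro continuous_intros R_cont)
  have "has_pv h (\<Sum>k\<in>UNIV. \<Sum>j\<in>UNIV. \<Sum>i\<in>UNIV. of_real (C $ k $ i * C $ k $ j) * complex_of_real (2 * pi * L $ i $ j))"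
    unfolding h_eq[abs_def] G_def R_def
    using has_pv_lyapunov[OF assms] by (intro has_pv_sum has_pv_cmul) simp
  also have "(\<Sum>k\<in>UNIV. \<Sum>j\<in>UNIV. \<Sum>i\<in>UNIV. of_real (C $ k $ i * C $ k $ j) * complex_of_real (2 * pi * L $ i $ j))
      = complex_of_real (2 * pi * trace (C ** L ** transpose C))"
    by (simp add: trace_def matrix_matrix_mult_def transpose_def sum_distrib_right sum_distrib_left mult_ac)
  finally have pv: "has_pv h (complex_of_real (2 * pi * trace (C ** L ** transpose C)))" .
  then have "((\<lambda>r. integral {-r..r} h) \<longlongrightarrow> complex_of_real (2 * pi * trace (C ** L ** transpose C))) at_top"
    by (simp add: has_pv_def)
  from tendsto_Re[OF this]
  have "((\<lambda>r. Re (integral {-r..r} h)) \<longlongrightarrow> 2 * pi * trace (C ** L ** transpose C)) at_top"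
    by simp
  moreover have "Re (integral {-r..r} h) = integral {-r..r} (\<lambda>\<omega>. Re (h \<omega>))" for r
    using pv by (auto simp: has_pv_def intro!: integral_unique[symmetric] has_integral_Re integrable_integral)
  ultimately have "integral\<^sup>L lborel (\<lambda>\<omega>. Re (h \<omega>)) = 2 * pi * trace (C ** L ** transpose C)"
    by (intro nonneg_integral_lborel h_cont) (auto simp: h_re sum_nonneg)
  then show ?thesis
    by (simp add: h2_norm_def h_def T_def R_def resolvent_def)
qed

section \<open>Matrix inequalities certifying the H2 norm\<close>

text \<open>The quadratic-form versions of the block matrix inequalities \<open>[\<Phi> + \<Phi>\<^sup>T, \<Psi>; \<Psi>\<^sup>T, -\<gamma>I] \<preceq> 0\<close> and
  \<open>[G, \<Theta>\<^sup>T; \<Theta>, \<Gamma>] \<succeq> 0\<close>. In this form they are visibly affine in all their arguments and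
  stable under congruence in the first block.\<close>

definition lyap_lmi :: "real^'n^'n \<Rightarrow> real^'k^'n \<Rightarrow> real \<Rightarrow> bool" where
  "lyap_lmi \<Phi> \<Psi> \<gamma> \<longleftrightarrow> (\<forall>x y. 2 * (x \<bullet> (\<Phi> *v x)) + 2 * (x \<bullet> (\<Psi> *v y)) \<le> \<gamma> * (y \<bullet> y))"

definition out_lmi :: "real^'n^'n \<Rightarrow> real^'n^'l \<Rightarrow> real^'l^'l \<Rightarrow> bool" where
  "out_lmi G \<Theta> \<Gamma> \<longleftrightarrow> transpose G = G \<and> transpose \<Gamma> = \<Gamma> \<and>
     (\<forall>x y. 0 \<le> x \<bullet> (G *v x) + 2 * ((\<Theta> *v x) \<bullet> y) + y \<bullet> (\<Gamma> *v y))"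

lemma nsd_block2_iff:
  "nsd (block2 (\<Phi> + transpose \<Phi>) \<Psi> (transpose \<Psi>) (- mat \<gamma>)) \<longleftrightarrow> lyap_lmi \<Phi> \<Psi> \<gamma>"
proof -
  have "transpose (- block2 (\<Phi> + transpose \<Phi>) \<Psi> (transpose \<Psi>) (- mat \<gamma>))
      = - block2 (\<Phi> + transpose \<Phi>) \<Psi> (transpose \<Psi>) (- mat \<gamma>)"
    by (simp add: transpose_block2 transpose_distribs add.commute)
  moreover have "vjoin x y \<bullet> (- block2 (\<Phi> + transpose \<Phi>) \<Psi> (transpose \<Psi>) (- mat \<gamma>) *v vjoin x y)
      = \<gamma> * (y \<bullet> y) - (2 * (x \<bullet> (\<Phi> *v x)) + 2 * (x \<bullet> (\<Psi> *v y)))" for x y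
    using inner_transpose'[of x \<Phi> x] inner_transpose'[of y \<Psi> x]
    by (simp add: matrix_vector_minus_left block2_vjoin inner_vjoin matrix_vector_mult_add_rdistrib
        inner_add_right mat_vector inner_diff_right)
  ultimately show ?thesis
    unfolding nsd_def psd_def lyap_lmi_def by (subst forall_vjoin) simp
qed

lemma psd_block2_iff:
  "psd (block2 G (transpose \<Theta>) \<Theta> \<Gamma>) \<longleftrightarrow> out_lmi G \<Theta> \<Gamma>"
proof -
  have "vjoin x y \<bullet> (block2 G (transpose \<Theta>) \<Theta> \<Gamma> *v vjoin x y)
      = x \<bullet> (G *v x) + 2 * ((\<Theta> *v x) \<bullet> y) + y \<bullet> (\<Gamma> *v y)" for x y
    using inner_transpose'[of x \<Theta> y]
    by (simp add: block2_vjoin inner_vjoin inner_add_right inner_commute)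
  then show ?thesis
    unfolding psd_def out_lmi_def
    by (subst forall_vjoin) (auto simp: transpose_block2 block2_eq_iff)
qed

lemma lyap_lmi_congruence:
  assumes "lyap_lmi \<Phi> \<Psi> \<gamma>"
  shows "lyap_lmi (transpose T ** \<Phi> ** T) (transpose T ** \<Psi>) \<gamma>"
  using assms unfolding lyap_lmi_def
  by (simp add: inner_transpose' flip: matrix_vector_mul_assoc) (metis inner_commute)

lemma out_lmi_congruence:
  assumes "out_lmi G \<Theta> \<Gamma>"
  shows "out_lmi (transpose T ** G ** T) (\<Theta> ** T) \<Gamma>"
proof -
  have "x \<bullet> ((transpose T ** G ** T) *v x) = (T *v x) \<bullet> (G *v (T *v x))" for x
    by (metis inner_commute inner_transpose matrix_vector_mul_assoc)
  then show ?thesis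
    using assms unfolding out_lmi_def
    by (simp add: matrix_transpose_mul matrix_mul_assoc flip: matrix_vector_mul_assoc)
qed

lemma psd_quadratic_mult_transpose: "x \<bullet> ((B ** transpose B) *v x) = (transpose B *v x) \<bullet> (transpose B *v (x::real^_))"
  by (simp add: inner_transpose flip: matrix_vector_mul_assoc)

lemma psd_mult_transpose: "psd (B ** transpose (B::real^_^_))"
  unfolding psd_def psd_quadratic_mult_transpose by (simp add: matrix_transpose_mul)

text \<open>With \<open>S = P\<^sup>-\<^sup>1\<close> the first inequality says \<open>AS + SA\<^sup>T + BB\<^sup>T/\<gamma> \<preceq> 0\<close>, so that \<open>\<gamma>S\<close> dominates the
  controllability Gramian \<open>L\<close>; the second one says \<open>CSC\<^sup>T \<preceq> \<Gamma>\<close>. Hence the squared H2 norm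
  \<open>tr(CLC\<^sup>T)\<close> is at most \<open>\<gamma> tr \<Gamma>\<close>.\<close>

lemma h2_norm_le_if_lmi:
  fixes A :: "real^'n^'n" and B :: "real^'k^'n" and C :: "real^'n^'l"
  assumes hur: "hurwitz A" and P: "pd P" and \<gamma>: "0 < \<gamma>" "trace \<Gamma> \<le> \<gamma>"
    and lmi1: "lyap_lmi (P ** A) (P ** B) \<gamma>" and lmi2: "out_lmi P C \<Gamma>"
  shows "h2_norm (\<lambda>s. cmat C ** matrix_inv (mat s - cmat A) ** cmat B) \<le> \<gamma>"
proof -
  define S where "S = matrix_inv P"
  have inv: "invertible P" using P by (rule pd_invertible)
  have PS: "P *v (S *v x) = x" for x
    by (simp add: S_def matrix_vector_mul_assoc matrix_inv_mult[OF inv])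
  have Ssym: "transpose S = S" using pd_matrix_inv[OF P] by (simp add: S_def pd_def)
  have Sin: "(S *v x) \<bullet> (P *v z) = x \<bullet> z" for x z
    by (metis PS P inner_commute inner_transpose pd_def)
  obtain L where L: "A ** L + L ** transpose A = - (B ** transpose B)"
    by (rule lyapunov_exists[OF hur])
  define D where "D = \<gamma> *\<^sub>R S - L"
  define E where "E = - (\<gamma> *\<^sub>R (A ** S + S ** transpose A) + B ** transpose B)"
  have "A ** D + D ** transpose A = - E"
    using L by (simp add: D_def E_def mat_distribs algebra_simps scaleR_add_right)
  moreover have "psd E"
    unfolding psd_def
  proof (intro conjI allI)
    show "transpose E = E"
      by (simp add: E_def transpose_distribs Ssym add.commute)
    fix x
    \<comment> \<open>Insert \<open>Sx\<close> and \<open>B\<^sup>T x/\<gamma>\<close> into the first inequality.\<close>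
    define b where "b = transpose B *v x"
    have "2 * ((S *v x) \<bullet> ((P ** A) *v (S *v x))) + 2 * ((S *v x) \<bullet> ((P ** B) *v ((1 / \<gamma>) *\<^sub>R b)))
        \<le> \<gamma> * (((1 / \<gamma>) *\<^sub>R b) \<bullet> ((1 / \<gamma>) *\<^sub>R b))"
      using lmi1 unfolding lyap_lmi_def by blast
    then have "2 * (x \<bullet> (A *v (S *v x))) + 2 * (1 / \<gamma>) * (b \<bullet> b) \<le> (1 / \<gamma>) * (b \<bullet> b)"
      using \<gamma>(1) inner_transpose[of B x b]
      by (simp add: Sin matrix_vector_mult_scaleR b_def flip: matrix_vector_mul_assoc)
    then have "\<gamma> * (2 * (x \<bullet> (A *v (S *v x))) + (1 / \<gamma>) * (b \<bullet> b)) \<le> 0"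
      using \<gamma>(1) by (intro mult_nonneg_nonpos) auto
    then have "\<gamma> * (2 * (x \<bullet> (A *v (S *v x)))) + b \<bullet> b \<le> 0"
      using \<gamma>(1) by (simp add: distrib_left)
    moreover have "x \<bullet> (S *v (transpose A *v x)) = x \<bullet> (A *v (S *v x))"
      by (metis Ssym inner_commute inner_transpose)
    ultimately show "0 \<le> x \<bullet> (E *v x)"
      by (simp add: E_def matrix_vector_minus_left matrix_vector_mult_add_rdistrib inner_add_right
          inner_transpose[where M = B, symmetric] b_def scaleR_matrix_vector_assoc[symmetric]
          matrix_vector_mul_assoc[symmetric] algebra_simps)
  qed
  ultimately have "psd D" by (rule lyapunov_psd[OF hur])
  from psd_congruence[OF this, of "transpose C"]
  have "0 \<le> trace (C ** D ** transpose C)" using trace_psd by force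
  then have tr1: "trace (C ** L ** transpose C) \<le> \<gamma> * trace (C ** S ** transpose C)"
    by (simp add: D_def mat_distribs trace_sub trace_scaleR)
  have "psd (\<Gamma> - C ** S ** transpose C)"
    unfolding psd_def
  proof (intro conjI allI)
    show "transpose (\<Gamma> - C ** S ** transpose C) = \<Gamma> - C ** S ** transpose C"
      using lmi2 by (simp add: out_lmi_def transpose_distribs Ssym matrix_mul_assoc)
    fix y
    \<comment> \<open>Insert \<open>-SC\<^sup>T y\<close> and \<open>y\<close> into the second inequality.\<close>
    define c where "c = transpose C *v y"
    have "0 \<le> (- (S *v c)) \<bullet> (P *v (- (S *v c))) + 2 * ((C *v (- (S *v c))) \<bullet> y) + y \<bullet> (\<Gamma> *v y)"
      using lmi2 unfolding out_lmi_def by blast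
    also have "(- (S *v c)) \<bullet> (P *v (- (S *v c))) = c \<bullet> (S *v c)"
      using Sin[of c "S *v c"] by (simp add: vec.neg)
    also have "(C *v (- (S *v c))) \<bullet> y = - (c \<bullet> (S *v c))"
      using inner_transpose[of C y "S *v c"] by (simp add: vec.neg c_def inner_commute)
    finally show "0 \<le> y \<bullet> ((\<Gamma> - C ** S ** transpose C) *v y)"
      using inner_transpose[of C y "S *v c"]
      by (simp add: matrix_vector_mult_diff_rdistrib inner_diff_right c_def flip: matrix_vector_mul_assoc)
  qed
  from trace_psd[OF this] have "trace (C ** S ** transpose C) \<le> \<gamma>"
    using \<gamma> by (simp add: trace_sub)
  then have "trace (C ** L ** transpose C) \<le> \<gamma> * \<gamma>"
    using tr1 \<gamma>(1) by (meson mult_left_mono order_trans less_imp_le)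
  then show ?thesis
    unfolding h2_norm_eq_gramian[OF hur L] using \<gamma>(1)
    by (intro real_le_lsqrt) (auto simp: power2_eq_square)
qed

text \<open>Conversely, any bound \<open>\<gamma>\<close> above the H2 norm is certified by \<open>P = S\<^sup>-\<^sup>1\<close> with \<open>S\<close> the Gramian of the
  slightly enlarged noise covariance \<open>(BB\<^sup>T + \<delta>I)/\<gamma>\<close>, which makes \<open>S\<close> invertible.\<close>

lemma lmi_if_h2_norm_less:
  fixes A :: "real^'n^'n" and B :: "real^'k^'n" and C :: "real^'n^'l"
  assumes hur: "hurwitz A" 
    and less: "h2_norm (\<lambda>s. cmat C ** matrix_inv (mat s - cmat A) ** cmat B) < \<gamma>"
  obtains P \<Gamma> where "pd P" "psd \<Gamma>" "trace \<Gamma> \<le> \<gamma>" "lyap_lmi (P ** A) (P ** B) \<gamma>" "out_lmi P C \<Gamma>"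
proof -
  obtain L where L: "A ** L + L ** transpose A = - (B ** transpose B)"
    by (rule lyapunov_exists[OF hur])
  obtain L1 where L1: "A ** L1 + L1 ** transpose A = - mat 1"
    by (rule lyapunov_exists[OF hur])
  have I: "pd (mat 1 :: real^'n^'n)" by (simp add: pd_def)
  have psds: "psd L" "psd L1"
    using lyapunov_psd[OF hur L psd_mult_transpose] lyapunov_psd[OF hur L1 pd_imp_psd[OF I]] by auto
  define a where "a = trace (C ** L ** transpose C)"
  define d where "d = trace (C ** L1 ** transpose C)"
  have ad: "0 \<le> a" "0 \<le> d"
    using trace_psd[OF psd_congruence[OF psds(1), of "transpose C"]]
      trace_psd[OF psd_congruence[OF psds(2), of "transpose C"]] by (auto simp: a_def d_def)
  have "sqrt a < \<gamma>" using less unfolding h2_norm_eq_gramian[OF hur L] a_def .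
  then have "0 < \<gamma>" using ad real_sqrt_ge_zero by (meson le_less_trans)
  have "a < \<gamma>\<^sup>2"
    using \<open>sqrt a < \<gamma>\<close> \<open>0 < \<gamma>\<close> by (metis real_sqrt_less_iff real_sqrt_unique less_imp_le)
  \<comment> \<open>The gap \<open>\<gamma>\<^sup>2 - a\<close> pays for the enlargement, which adds \<open>\<delta>d\<close> to the squared norm \<open>a\<close>.\<close>
  define \<delta> where "\<delta> = (\<gamma>\<^sup>2 - a) / (1 + d)"
  have "0 < \<delta>" using \<open>a < \<gamma>\<^sup>2\<close> ad by (simp add: \<delta>_def)
  have "\<delta> * d \<le> \<gamma>\<^sup>2 - a"
    using \<open>a < \<gamma>\<^sup>2\<close> ad by (simp add: \<delta>_def field_simps)
  define S where "S = (1 / \<gamma>) *\<^sub>R (L + \<delta> *\<^sub>R L1)"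
  define E where "E = (1 / \<gamma>) *\<^sub>R (B ** transpose B + \<delta> *\<^sub>R mat 1)"
  have S_eq: "A ** S + S ** transpose A = - E"
  proof -
    have "A ** S + S ** transpose A = (1 / \<gamma>) *\<^sub>R ((A ** L + L ** transpose A) + \<delta> *\<^sub>R (A ** L1 + L1 ** transpose A))"
      by (simp add: S_def mat_distribs algebra_simps scaleR_add_right)
    then show ?thesis unfolding L L1 E_def by (simp only: scaleR_add_right scaleR_minus_right minus_add_distrib)
  qed
  have "pd E"
    unfolding E_def add.commute[of "B ** transpose B"]
    using \<open>0 < \<gamma>\<close> \<open>0 < \<delta>\<close> by (intro pd_scaleR pd_add_psd I psd_mult_transpose) auto
  then have S: "pd S" by (rule lyapunov_pd[OF hur S_eq])
  have Ssym: "transpose S = S" using S by (simp add: pd_def)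
  define P where "P = matrix_inv S"
  have P: "pd P" unfolding P_def using S by (rule pd_matrix_inv)
  have Psym: "transpose P = P" using P by (simp add: pd_def)
  have SP: "S *v (P *v x) = x" and PS: "P *v (S *v x) = x" for x
    using pd_invertible[OF S] by (simp_all add: P_def matrix_vector_mul_assoc matrix_inv_mult)
  have "lyap_lmi (P ** A) (P ** B) \<gamma>"
    unfolding lyap_lmi_def
  proof (intro allI)
    fix x y
    define z where "z = P *v x"
    define b where "b = transpose B *v z"
    have "x \<bullet> ((P ** A) *v x) = z \<bullet> ((A ** S) *v z)"
      using inner_transpose[of P x "A *v x"]
      by (simp add: z_def Psym SP flip: matrix_vector_mul_assoc)
    moreover have "z \<bullet> ((S ** transpose A) *v z) = z \<bullet> ((A ** S) *v z)"
      by (metis Ssym inner_transpose' matrix_transpose_mul)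
    moreover have "z \<bullet> ((A ** S) *v z) + z \<bullet> ((S ** transpose A) *v z) = - ((b \<bullet> b + \<delta> * (z \<bullet> z)) / \<gamma>)"
      using arg_cong[OF S_eq, of "\<lambda>M. z \<bullet> (M *v z)"]
      by (simp add: E_def matrix_vector_mult_add_rdistrib inner_add_right matrix_vector_minus_left
          scaleR_matrix_vector_assoc[symmetric] psd_quadratic_mult_transpose b_def add_divide_distrib)
    ultimately have 1: "2 * (x \<bullet> ((P ** A) *v x)) = - ((b \<bullet> b + \<delta> * (z \<bullet> z)) / \<gamma>)"
      by simp
    have 2: "x \<bullet> ((P ** B) *v y) = b \<bullet> y"
      using inner_transpose[of P x "B *v y"] inner_transpose[of B z y]
      by (simp add: b_def z_def Psym flip: matrix_vector_mul_assoc)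
    have "0 \<le> (b - \<gamma> *\<^sub>R y) \<bullet> (b - \<gamma> *\<^sub>R y)" by simp
    then have "2 * \<gamma> * (b \<bullet> y) \<le> b \<bullet> b + \<gamma> * \<gamma> * (y \<bullet> y)"
      by (simp add: inner_diff_left inner_diff_right inner_commute algebra_simps)
    then have "2 * \<gamma> * (b \<bullet> y) \<le> b \<bullet> b + \<delta> * (z \<bullet> z) + \<gamma> * \<gamma> * (y \<bullet> y)"
      using mult_nonneg_nonneg[OF less_imp_le[OF \<open>0 < \<delta>\<close>] inner_ge_zero[of z]] by linarith
    then show "2 * (x \<bullet> ((P ** A) *v x)) + 2 * (x \<bullet> ((P ** B) *v y)) \<le> \<gamma> * (y \<bullet> y)"
      unfolding 1 2 using \<open>0 < \<gamma>\<close> by (simp add: field_simps)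
  qed
  moreover define \<Gamma> where "\<Gamma> = C ** S ** transpose C"
  have "psd \<Gamma>"
    using psd_congruence[OF pd_imp_psd[OF S], of "transpose C"] by (simp add: \<Gamma>_def)
  moreover have "trace \<Gamma> \<le> \<gamma>"
  proof -
    have "trace \<Gamma> = (1 / \<gamma>) * (a + \<delta> * d)"
      unfolding \<Gamma>_def S_def a_def d_def by (simp add: mat_distribs trace_scaleR trace_add)
    also have "\<dots> \<le> (1 / \<gamma>) * \<gamma>\<^sup>2"
      using \<open>\<delta> * d \<le> \<gamma>\<^sup>2 - a\<close> \<open>0 < \<gamma>\<close> by (intro mult_left_mono) auto
    finally show ?thesis using \<open>0 < \<gamma>\<close> by (simp add: power2_eq_square)
  qed
  moreover have "out_lmi P C \<Gamma>"
    unfolding out_lmi_def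
  proof (intro conjI allI)
    show "transpose P = P" by (rule Psym)
    show "transpose \<Gamma> = \<Gamma>" using \<open>psd \<Gamma>\<close> by (simp add: psd_def)
    fix x y
    define c where "c = S *v (transpose C *v y)"
    have "0 \<le> (x + c) \<bullet> (P *v (x + c))"
      using pd_imp_psd[OF P] by (simp add: psd_def)
    also have "\<dots> = x \<bullet> (P *v x) + 2 * (x \<bullet> (P *v c)) + c \<bullet> (P *v c)"
      using inner_transpose'[of c P x]
      by (simp add: Psym matrix_vector_right_distrib inner_add_left inner_add_right)
    also have "P *v c = transpose C *v y" by (simp add: c_def PS)
    also have "x \<bullet> (transpose C *v y) = (C *v x) \<bullet> y"
      by (simp add: inner_transpose' inner_commute)
    also have "c \<bullet> (transpose C *v y) = y \<bullet> (\<Gamma> *v y)"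
      using inner_transpose'[of c C y] by (simp add: c_def \<Gamma>_def flip: matrix_vector_mul_assoc)
    finally show "0 \<le> x \<bullet> (P *v x) + 2 * ((C *v x) \<bullet> y) + y \<bullet> (\<Gamma> *v y)" .
  qed
  ultimately show thesis using that P by blast
qed

section \<open>Controllability and a shifted Gramian\<close>

text \<open>An \<open>A\<^sup>T\<close>-invariant set annihilated by \<open>B\<^sup>T\<close> is orthogonal to all columns of the
  controllability matrix.\<close>

lemma controllable_trivial_unobservable:
  fixes A :: "real^'n^'n" and B :: "real^'k^'n"
  assumes con: "controllable A B" and "x \<in> U"
    and inv: "\<And>u. u \<in> U \<Longrightarrow> transpose A *v u \<in> U" and ker: "\<And>u. u \<in> U \<Longrightarrow> transpose B *v u = 0"
  shows "x = 0"
proof -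
  let ?S = "\<Union>k<CARD('n). columns (((\<lambda>M. A ** M) ^^ k) B)"
  have zero: "transpose (((\<lambda>M. A ** M) ^^ k) B) *v u = 0" if "u \<in> U" for k u
    using that
  proof (induction k arbitrary: u)
    case (Suc k)
    then show ?case
      using inv by (simp add: matrix_transpose_mul flip: matrix_vector_mul_assoc)
  qed (simp add: ker)
  have "orthogonal x s" if "s \<in> ?S" for s
  proof -
    have "\<exists>k j. s = column j (((\<lambda>M. A ** M) ^^ k) B)"
      using that unfolding columns_def by blast
    then obtain k j where "s = column j (((\<lambda>M. A ** M) ^^ k) B)" by blast
    then have "s \<bullet> x = (transpose (((\<lambda>M. A ** M) ^^ k) B) *v x) $ j"
      by (simp add: column_def transpose_def matrix_vector_mult_def inner_vec_def)
    then show ?thesis using zero[OF \<open>x \<in> U\<close>] by (simp add: orthogonal_def inner_commute)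
  qed
  moreover have "span ?S = UNIV"
    using con by (simp add: controllable_def dim_eq_full[symmetric])
  ultimately have "orthogonal x x"
    by (intro orthogonal_to_span[of x ?S x]) auto
  then show ?thesis by (simp add: orthogonal_def)
qed

lemma controllable_transpose:
  assumes "observable C A"
  shows "controllable (transpose A) (transpose C)"
proof -
  have "((\<lambda>M. transpose A ** M) ^^ k) (transpose C) = transpose (((\<lambda>M. M ** A) ^^ k) C)" for k
    by (induction k) (simp_all add: matrix_transpose_mul)
  then show ?thesis using assms by (simp add: controllable_def observable_def)
qed

text \<open>Bass's construction: \<open>-(A + bI)\<close> is stable for large \<open>b = \<beta>/2\<close>, and its Gramian \<open>Z\<close> is positive definite
  because its kernel is an \<open>A\<^sup>T\<close>-invariant subspace annihilated by \<open>B\<^sup>T\<close>. The feedback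
  \<open>-B\<^sup>TZ\<^sup>-\<^sup>1\<close> then satisfies a strict Lyapunov inequality.\<close>

lemma bass_gramian:
  fixes A :: "real^'n^'n" and B :: "real^'k^'n"
  assumes "controllable A B"
  obtains Z \<beta> where "pd Z" "0 < \<beta>" "A ** Z + Z ** transpose A - 2 *\<^sub>R (B ** transpose B) = - (\<beta> *\<^sub>R Z)"
proof -
  obtain k where k: "0 < k" "\<And>x. norm (A *v x) \<le> norm x * k"
    using bounded_linear.pos_bounded[OF matrix_vector_mul_bounded_linear[of A]] by blast
  define b where "b = k + 1"
  define D where "D = - (A + mat b)"
  have hur: "hurwitz D"
  proof (rule hurwitz_if_lyapunov)
    show "pd (mat 1 :: real^'n^'n)" by (simp add: pd_def)
    fix x :: "real^'n" assume "x \<noteq> 0"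
    have "- (x \<bullet> (A *v x)) \<le> norm x * norm (A *v x)"
      using Cauchy_Schwarz_ineq2[of x "A *v x"] by linarith
    also have "\<dots> \<le> norm x * (norm x * k)" by (intro mult_left_mono k) simp
    also have "\<dots> = k * (x \<bullet> x)" by (simp add: dot_square_norm power2_eq_square)
    also have "\<dots> < b * (x \<bullet> x)" using \<open>x \<noteq> 0\<close> by (simp add: b_def)
    finally show "x \<bullet> (mat 1 *v (D *v x)) < 0"
      by (simp add: D_def matrix_vector_minus_left matrix_vector_mult_diff_rdistrib mat_vector inner_diff_right)
  qed
  let ?Q = "2 *\<^sub>R (B ** transpose B)"
  obtain Z where Z: "D ** Z + Z ** transpose D = - ?Q"
    by (rule lyapunov_exists[OF hur])
  have matb: "mat b ** Z = b *\<^sub>R Z" "Z ** mat b = b *\<^sub>R Z"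
    by (simp_all add: vec_eq_iff mat_mult_nth flip: mat_mult_commute)
  have eq: "A ** Z + Z ** transpose A - ?Q = - ((2 * b) *\<^sub>R Z)"
  proof -
    have "A ** Z + Z ** transpose A + (2 * b) *\<^sub>R Z = - (D ** Z + Z ** transpose D)"
      by (simp add: D_def transpose_distribs mat_distribs matb algebra_simps scaleR_2[symmetric])
        (simp add: vec_eq_iff)
    then show ?thesis unfolding Z by (simp add: algebra_simps)
  qed
  have psd: "psd Z"
    by (rule lyapunov_psd[OF hur Z]) (intro psd_scaleR psd_mult_transpose, simp)
  have "x = 0" if "x \<bullet> (Z *v x) = 0" for x
  proof (rule controllable_trivial_unobservable[OF assms, of x "{u. Z *v u = 0}"])
    show "x \<in> {u. Z *v u = 0}" using psd_kernel[OF psd that] by simp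
    fix u assume "u \<in> {u. Z *v u = 0}"
    then have u: "Z *v u = 0" by simp
    have ZAu: "Z *v (transpose A *v u) = 2 *\<^sub>R (B *v (transpose B *v u))"
      using arg_cong[OF eq, of "\<lambda>M. M *v u"] u
      by (simp add: matrix_vector_mult_diff_rdistrib matrix_vector_mult_add_rdistrib
          matrix_vector_minus_left scaleR_matrix_vector_assoc[symmetric] matrix_vector_mul_assoc[symmetric])
    have "u \<bullet> (Z *v (transpose A *v u)) = 0"
      using psd u by (metis inner_transpose inner_zero_left psd_def)
    then show Bu: "transpose B *v u = 0"
      unfolding ZAu using inner_transpose[of B u "transpose B *v u"] by simp
    show "transpose A *v u \<in> {u. Z *v u = 0}" using ZAu Bu by simp
  qed
  then have "pd Z" using psd by (force simp: pd_def psd_def order.order_iff_strict)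
  then show thesis using that[OF _ _ eq] k(1) by (simp add: b_def)
qed

section \<open>The change of variables\<close>

text \<open>The leading block of the first matrix inequality defining the convex set is \<open>\<Phi> + \<Phi>\<^sup>T\<close> for the
  following matrix \<open>\<Phi>\<close>, affine in \<open>(\<Lambda>, X, Y)\<close>.\<close>

definition F_Phi :: "real^'n^'n \<Rightarrow> real^'m^'n \<Rightarrow> real^'n^'p \<Rightarrow>
    real^('p::finite + 'n::finite)^('m::finite + 'n) \<Rightarrow> real^'n^'n \<Rightarrow> real^'n^'n \<Rightarrow> real^('n + 'n)^('n + 'n)" where
  "F_Phi A B C \<Lambda> X Y = block2 (A ** X + B ** blk12 \<Lambda>) A (blk22 \<Lambda>) (Y ** A + blk21 \<Lambda> ** C)"

text \<open>The coefficient of the disturbance in the first inequality.\<close>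

definition F_Psi :: "real^'n^'n \<Rightarrow> real^'p^'p \<Rightarrow>
    real^('p::finite + 'n::finite)^('m::finite + 'n) \<Rightarrow> real^'n^'n \<Rightarrow> real^('n + 'p)^('n + 'n)" where
  "F_Psi W V \<Lambda> Y = vcat (B1 W) (Y ** B1 W + blk21 \<Lambda> ** D21 V)"

text \<open>The output block of the second inequality.\<close>

definition F_Theta :: "real^'n^'n \<Rightarrow> real^'m^'m \<Rightarrow>
    real^('p::finite + 'n::finite)^('m::finite + 'n) \<Rightarrow> real^'n^'n \<Rightarrow> real^('n + 'n)^('n + 'm)" where
  "F_Theta Q R \<Lambda> X = hcat (C1 Q ** X + D12 R ** blk12 \<Lambda>) (C1 Q)"

text \<open>The matrix \<open>[X, I; I, Y]\<close>, which is \<open>T\<^sup>T P T\<close> under the change of variables.\<close>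

definition F_G :: "real^'n^'n \<Rightarrow> real^'n^'n \<Rightarrow> real^('n::finite + 'n)^('n + 'n)" where
  "F_G X Y = block2 X (mat 1) (mat 1) Y"

text \<open>The conditions defining the convex set except for the definiteness of \<open>[X, I; I, Y]\<close>, which is
  then still positive semidefinite. Every pair of a policy and a Lyapunov certificate gives such a point,
  whether or not the certificate has an invertible off-diagonal block.\<close>

definition relaxed_point where
  "relaxed_point A B C Q R W V \<gamma> \<Lambda> X Y \<Gamma> \<longleftrightarrow> \<Lambda> \<in> policy_space \<and> psd \<Gamma> \<and> trace \<Gamma> \<le> \<gamma> \<and>
     lyap_lmi (F_Phi A B C \<Lambda> X Y) (F_Psi W V \<Lambda> Y) \<gamma> \<and> out_lmi (F_G X Y) (F_Theta Q R \<Lambda> X) \<Gamma>"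

text \<open>Points at which in addition \<open>[X, I; I, Y]\<close> is positive definite and the leading block of the first
  matrix inequality is negative definite, with \<open>\<gamma> > 0\<close>. This is what makes the reconstructed closed loop Hurwitz; at a
  general point of the convex set it may have eigenvalues on the imaginary axis.\<close>

definition strict_point where
  "strict_point A B C Q R W V \<gamma> \<Lambda> X Y \<Gamma> \<longleftrightarrow> relaxed_point A B C Q R W V \<gamma> \<Lambda> X Y \<Gamma> \<and> pd (F_G X Y) \<and>
     0 < \<gamma> \<and> (\<forall>x. x \<noteq> 0 \<longrightarrow> x \<bullet> (F_Phi A B C \<Lambda> X Y *v x) < 0)"

lemma F_LQG_iff:
  "(\<gamma>, \<Lambda>, X, Y, \<Gamma>) \<in> F_LQG A B C Q R W V \<longleftrightarrow> relaxed_point A B C Q R W V \<gamma> \<Lambda> X Y \<Gamma> \<and> pd (F_G X Y)"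
proof -
  have sym: "transpose X = X \<and> transpose Y = Y" if "pd (F_G X Y)"
    using that by (simp add: pd_def F_G_def transpose_block2 block2_eq_iff)
  let ?S1 = "A ** X + B ** blk12 \<Lambda>" and ?S2 = "Y ** A + blk21 \<Lambda> ** C"
  have 1: "block2 (?S1 + transpose ?S1) (transpose (blk22 \<Lambda>) + A) (blk22 \<Lambda> + transpose A)
      (?S2 + transpose ?S2) = F_Phi A B C \<Lambda> X Y + transpose (F_Phi A B C \<Lambda> X Y)"
    by (simp add: F_Phi_def transpose_block2 block2_add add.commute)
  have 2: "hcat (transpose (B1 W)) (transpose (Y ** B1 W + blk21 \<Lambda> ** D21 V)) = transpose (F_Psi W V \<Lambda> Y)"
    by (simp add: F_Psi_def transpose_vcat)
  have 3: "vcat (transpose (C1 Q ** X + D12 R ** blk12 \<Lambda>)) (transpose (C1 Q)) = transpose (F_Theta Q R \<Lambda> X)"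
    by (simp add: F_Theta_def transpose_hcat)
  show ?thesis
    unfolding F_LQG_def relaxed_point_def Let_def mem_Collect_eq prod.case 1 2 3
    using sym by (auto simp: nsd_block2_iff psd_block2_iff F_G_def[symmetric] F_Psi_def[symmetric] F_Theta_def[symmetric])
qed

lemma J_LQG_eq:
  assumes "K \<in> policy_space"
  shows "J_LQG A B C Q R W V K = h2_norm (\<lambda>s. cmat (Ccl C Q R K)
    ** matrix_inv (mat s - cmat (Acl A B C K)) ** cmat (Bcl B W V K))"
proof -
  have "cmat (Dcl R V K) = 0"
    using assms by (simp add: Dcl_def policy_space_def block_defs)
  then show ?thesis by (simp add: J_LQG_def Tzd_def[abs_def])
qed

text \<open>If \<open>P\<close> has the first block row \<open>(Y, N)\<close> and \<open>P\<^sup>-\<^sup>1\<close> the first block column \<open>(X, U)\<close>, then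
  \<open>P T = E\<close> for the following two matrices. Congruence with \<open>T\<close> is the change of variables.\<close>

definition T_mat :: "real^'n^'n \<Rightarrow> real^'n^'n \<Rightarrow> real^('n::finite + 'n)^('n + 'n)" where
  "T_mat X U = block2 X (mat 1) U 0"

text \<open>The product \<open>P T\<close>, which no longer involves the remaining blocks of \<open>P\<close> and \<open>P\<^sup>-\<^sup>1\<close>.\<close>

definition E_mat :: "real^'n^'n \<Rightarrow> real^'n^'n \<Rightarrow> real^('n::finite + 'n)^('n + 'n)" where
  "E_mat Y N = block2 (mat 1) Y 0 (transpose N)"

text \<open>The new variables \<open>\<Lambda> = [0, F; H, M]\<close> as functions of a policy and of \<open>N\<close>, \<open>X\<close>, \<open>Y\<close>, \<open>U\<close>; they are
  chosen so that \<open>E\<^sup>T A\<^sub>c\<^sub>l T\<close> is affine in \<open>(\<Lambda>, X, Y)\<close>.\<close>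

definition lift_policy :: "real^'n^'n \<Rightarrow> real^'m^'n \<Rightarrow> real^'n^'p \<Rightarrow>
    real^'n^'n \<Rightarrow> real^'n^'n \<Rightarrow> real^'n^'n \<Rightarrow> real^'n^'n \<Rightarrow>
    real^('p::finite + 'n::finite)^('m::finite + 'n) \<Rightarrow> real^('p + 'n)^('m + 'n)" where
  "lift_policy A B C N X Y U K = block2 0 (CK K ** U) (N ** BK K)
     (Y ** A ** X + N ** BK K ** C ** X + Y ** B ** CK K ** U + N ** AK K ** U)"

text \<open>Its inverse, for a given invertible \<open>N\<close>: here \<open>U\<close> is determined by \<open>Y X + N U = I\<close>.\<close>

definition policy_of :: "real^'n^'n \<Rightarrow> real^'m^'n \<Rightarrow> real^'n^'p \<Rightarrow> real^'n^'n \<Rightarrow>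
    real^('p::finite + 'n::finite)^('m::finite + 'n) \<Rightarrow> real^'n^'n \<Rightarrow> real^'n^'n \<Rightarrow> real^('p + 'n)^('m + 'n)" where
  "policy_of A B C N \<Lambda> X Y =
     (let U = matrix_inv N ** (mat 1 - Y ** X); F = blk12 \<Lambda>; H = blk21 \<Lambda>; M = blk22 \<Lambda> in
      block2 0 (F ** matrix_inv U) (matrix_inv N ** H)
        (matrix_inv N ** (M - Y ** A ** X - H ** C ** X - Y ** B ** F) ** matrix_inv U))"

lemma closed_loop_transform:
  assumes "K \<in> policy_space" and Y: "transpose Y = Y"
    and \<Lambda>_def: "\<Lambda> = lift_policy A B C N X Y U K"
  shows "transpose (E_mat Y N) ** (Acl A B C K ** T_mat X U) = F_Phi A B C \<Lambda> X Y"
    and "transpose (E_mat Y N) ** Bcl B W V K = F_Psi W V \<Lambda> Y"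
    and "Ccl C Q R K ** T_mat X U = F_Theta Q R \<Lambda> X"
proof -
  have K: "DK K = 0" using assms by (simp add: policy_space_def)
  show "transpose (E_mat Y N) ** (Acl A B C K ** T_mat X U) = F_Phi A B C \<Lambda> X Y"
    by (simp add: \<Lambda>_def E_mat_def T_mat_def Acl_def F_Phi_def lift_policy_def transpose_block2
        block2_mult block2_eq_iff K Y mat_distribs matrix_mul_assoc add_ac)
  show "transpose (E_mat Y N) ** Bcl B W V K = F_Psi W V \<Lambda> Y"
    by (simp add: \<Lambda>_def E_mat_def Bcl_def F_Psi_def lift_policy_def transpose_block2 B1_def D21_def
        block2_mult mult_hcat hcat_add vcat_hcat block2_eq_iff K Y mat_distribs matrix_mul_assoc)
  show "Ccl C Q R K ** T_mat X U = F_Theta Q R \<Lambda> X"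
    by (simp add: \<Lambda>_def T_mat_def Ccl_def F_Theta_def lift_policy_def C1_def D12_def
        block2_mult vcat_mult vcat_add hcat_vcat block2_eq_iff K matrix_mul_assoc)
qed

lemma T_transpose_E:
  assumes "Y ** X + N ** U = mat 1" "transpose X = X" "transpose Y = Y"
  shows "transpose (T_mat X U) ** E_mat Y N = F_G X Y"
proof -
  have "X ** Y + transpose U ** transpose N = mat 1"
    using arg_cong[OF assms(1), of transpose] by (simp add: transpose_distribs assms(2,3))
  then show ?thesis
    by (simp add: T_mat_def E_mat_def F_G_def transpose_block2 block2_mult assms(2,3))
qed

lemma F_G_pd_invertible:
  assumes "pd (F_G X Y)" shows "invertible (mat 1 - Y ** X)"
proof (rule invertible_if_kernel_trivial)
  fix x assume "(mat 1 - Y ** X) *v x = 0"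
  then have "F_G X Y *v vjoin x (- (X *v x)) = 0"
    by (simp add: F_G_def block2_vjoin vjoin_eq_0_iff matrix_vector_mult_diff_rdistrib
        vec.neg flip: matrix_vector_mul_assoc)
  then have "vjoin x (- (X *v x)) = 0"
    using assms by (metis inner_zero_right less_irrefl pd_def)
  then show "x = 0" by (simp add: vjoin_eq_0_iff)
qed

lemma policy_of_in_policy_space: "policy_of A B C N \<Lambda> X Y \<in> policy_space"
  by (simp add: policy_of_def policy_space_def DK_def Let_def)

lemma invertible_matrix_inv: "invertible (N :: real^'n^'n) \<Longrightarrow> invertible (matrix_inv N)"
  using matrix_inv_mult invertible_def by blast

lemma matrix_inv_cancel:
  assumes "invertible U"
  shows "M ** matrix_inv U ** U = M" "M ** U ** matrix_inv U = M"
  by (simp_all add: matrix_inv_mult[OF assms] flip: matrix_mul_assoc)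

lemma lift_policy_of:
  assumes "\<Lambda> \<in> policy_space" "invertible N" "pd (F_G X Y)"
  defines "U \<equiv> matrix_inv N ** (mat 1 - Y ** X)"
  shows "lift_policy A B C N X Y U (policy_of A B C N \<Lambda> X Y) = \<Lambda>"
proof -
  have U: "invertible U"
    unfolding U_def by (intro invertible_mult invertible_matrix_inv F_G_pd_invertible assms)
  define Z where "Z = blk22 \<Lambda> - Y ** A ** X - blk21 \<Lambda> ** C ** X - Y ** B ** blk12 \<Lambda>"
  have K: "CK (policy_of A B C N \<Lambda> X Y) = blk12 \<Lambda> ** matrix_inv U"
    "BK (policy_of A B C N \<Lambda> X Y) = matrix_inv N ** blk21 \<Lambda>"
    "AK (policy_of A B C N \<Lambda> X Y) = matrix_inv N ** Z ** matrix_inv U"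
    by (simp_all add: policy_of_def Let_def CK_def BK_def AK_def U_def Z_def)
  have "lift_policy A B C N X Y U (policy_of A B C N \<Lambda> X Y)
      = block2 0 (blk12 \<Lambda>) (blk21 \<Lambda>) (blk22 \<Lambda>)"
    by (simp add: lift_policy_def K matrix_mul_assoc matrix_inv_cancel[OF U] matrix_inv_mult[OF assms(2)]) (simp add: Z_def)
  also have "\<dots> = \<Lambda>"
    using assms(1) block2_blk[of \<Lambda>] by (simp add: policy_space_def DK_def)
  finally show ?thesis .
qed

lemma policy_of_lift:
  assumes "K \<in> policy_space" "invertible N" "pd (F_G X Y)" "Y ** X + N ** U = mat 1"
  shows "policy_of A B C N (lift_policy A B C N X Y U K) X Y = K"
proof -
  have "N ** U = mat 1 - Y ** X" using assms(4) by (simp add: algebra_simps)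
  then have U_eq: "matrix_inv N ** (mat 1 - Y ** X) = U"
    by (metis assms(2) matrix_inv_mult(2) matrix_mul_assoc matrix_mul_lid)
  have U: "invertible U"
    unfolding U_eq[symmetric] by (intro invertible_mult invertible_matrix_inv F_G_pd_invertible assms)
  have 1: "CK K ** U ** matrix_inv U = CK K"
    by (simp add: matrix_inv_mult[OF U] flip: matrix_mul_assoc)
  have 2: "matrix_inv N ** (N ** BK K) = BK K"
    by (simp add: matrix_mul_assoc matrix_inv_mult[OF assms(2)])
  have 3: "matrix_inv N ** (N ** AK K ** U) ** matrix_inv U = AK K"
    by (simp add: matrix_mul_assoc matrix_inv_mult[OF assms(2)])
      (simp add: matrix_inv_mult[OF U] flip: matrix_mul_assoc)
  have "policy_of A B C N (lift_policy A B C N X Y U K) X Y = block2 0 (CK K) (BK K) (AK K)"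
    by (simp add: policy_of_def Let_def U_eq lift_policy_def 1 2 matrix_mul_assoc[of Y B])
      (simp add: matrix_mul_assoc 3[unfolded matrix_mul_assoc] 1)
  also have "\<dots> = K"
    using assms(1) block2_blk[of K] by (simp add: policy_space_def DK_def CK_def BK_def AK_def)
  finally show ?thesis .
qed

text \<open>From policies to the convex set: congruence with \<open>T\<close>, which may be singular.\<close>

lemma relaxed_point_of_policy:
  assumes K: "K \<in> policy_space" and P: "pd P" and \<Gamma>: "psd \<Gamma>" "trace \<Gamma> \<le> \<gamma>"
    and lmi1: "lyap_lmi (P ** Acl A B C K) (P ** Bcl B W V K) \<gamma>" and lmi2: "out_lmi P (Ccl C Q R K) \<Gamma>"
  obtains X Y U where "Y ** X + blk12 P ** U = mat 1"
    "relaxed_point A B C Q R W V \<gamma> (lift_policy A B C (blk12 P) X Y U K) X Y \<Gamma>"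
    "invertible (blk12 P) \<Longrightarrow> pd (F_G X Y)"
proof -
  define S where "S = matrix_inv P"
  define X where "X = blk11 S"
  define U where "U = blk21 S"
  define Y where "Y = blk11 P"
  define N where "N = blk12 P"
  have Ptr: "transpose P = P" using P by (simp add: pd_def)
  have Str: "transpose S = S" using pd_matrix_inv[OF P] by (simp add: pd_def S_def)
  have Pb: "P = block2 Y N (transpose N) (blk22 P)" and Y: "transpose Y = Y"
    using Ptr block2_blk[of P] by (metis Y_def N_def block2_eq_iff transpose_block2)+
  have X: "transpose X = X"
    using Str block2_blk[of S] by (metis X_def block2_eq_iff transpose_block2)
  have PS: "P ** S = mat 1"
    using pd_invertible[OF P] by (simp add: S_def matrix_inv_mult)
  have "block2 Y N (transpose N) (blk22 P) ** block2 X (blk12 S) U (blk22 S) = block2 (mat 1) 0 0 (mat 1)"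
    using PS Pb block2_blk[of S] by (simp add: X_def U_def mat_1_block2)
  then have YX: "Y ** X + N ** U = mat 1" and 0: "transpose N ** X + blk22 P ** U = 0"
    by (simp_all add: block2_mult block2_eq_iff)
  have PT: "P ** T_mat X U = E_mat Y N"
    by (subst Pb) (simp add: T_mat_def E_mat_def block2_mult YX 0)
  have TP: "transpose (T_mat X U) ** P = transpose (E_mat Y N)"
    using PT Ptr by (metis matrix_transpose_mul)
  have TPT: "transpose (T_mat X U) ** P ** T_mat X U = F_G X Y"
    using T_transpose_E[OF YX X Y] PT by (metis matrix_mul_assoc)
  let ?L = "lift_policy A B C N X Y U K"
  note tr = closed_loop_transform[OF K Y refl]
  have "lyap_lmi (F_Phi A B C ?L X Y) (F_Psi W V ?L Y) \<gamma>"
    using lyap_lmi_congruence[OF lmi1, of "T_mat X U"] TP tr(1,2)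
    by (simp add: matrix_mul_assoc)
  moreover have "out_lmi (F_G X Y) (F_Theta Q R ?L X) \<Gamma>"
    using out_lmi_congruence[OF lmi2, of "T_mat X U"] unfolding TPT tr(3)[where A = A and B = B and N = N] .
  moreover have "?L \<in> policy_space"
    by (simp add: lift_policy_def policy_space_def DK_def)
  ultimately have "relaxed_point A B C Q R W V \<gamma> ?L X Y \<Gamma>"
    using \<Gamma> by (simp add: relaxed_point_def)
  moreover have "pd (F_G X Y)" if "invertible N"
    unfolding TPT[symmetric]
  proof (rule pd_congruence[OF P])
    fix z assume "T_mat X U *v z = 0"
    then have "E_mat Y N *v z = 0"
      by (simp flip: PT matrix_vector_mul_assoc)
    moreover obtain x y where z: "z = vjoin x y" by (rule vjoin_cases)
    ultimately have "x + Y *v y = 0" "transpose N *v y = 0"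
      by (simp_all add: E_mat_def block2_vjoin vjoin_eq_0_iff)
    moreover have "y = 0"
    proof -
      have "transpose (matrix_inv N) *v (transpose N *v y) = y"
        using that by (simp add: matrix_vector_mul_assoc matrix_inv_mult flip: matrix_transpose_mul)
      then show ?thesis using \<open>transpose N *v y = 0\<close> by simp
    qed
    ultimately show "z = 0" by (simp add: z vjoin_eq_0_iff)
  qed
  ultimately show thesis using that YX by (simp add: N_def)
qed

text \<open>From strict points back to policies. Since \<open>T\<close> is invertible here, the congruence can be undone,
  with \<open>P = T\<^sup>-\<^sup>T [X, I; I, Y] T\<^sup>-\<^sup>1\<close>; any invertible \<open>N\<close> will do.\<close>

lemma strict_point_policy:
  assumes "strict_point A B C Q R W V \<gamma> \<Lambda> X Y \<Gamma>" and N: "invertible N"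
  shows "policy_of A B C N \<Lambda> X Y \<in> stabilizing A B C"
    and "J_LQG A B C Q R W V (policy_of A B C N \<Lambda> X Y) \<le> \<gamma>"
proof -
  let ?K = "policy_of A B C N \<Lambda> X Y"
  have K: "?K \<in> policy_space" by (rule policy_of_in_policy_space)
  have G: "pd (F_G X Y)" and neg: "\<And>x. x \<noteq> 0 \<Longrightarrow> x \<bullet> (F_Phi A B C \<Lambda> X Y *v x) < 0"
    and \<Gamma>: "trace \<Gamma> \<le> \<gamma>" "0 < \<gamma>" and \<Lambda>: "\<Lambda> \<in> policy_space"
    and lmi1: "lyap_lmi (F_Phi A B C \<Lambda> X Y) (F_Psi W V \<Lambda> Y) \<gamma>"
    and lmi2: "out_lmi (F_G X Y) (F_Theta Q R \<Lambda> X) \<Gamma>"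
    using assms(1) by (auto simp: strict_point_def relaxed_point_def)
  have X: "transpose X = X" and Y: "transpose Y = Y"
    using G by (simp_all add: pd_def F_G_def transpose_block2 block2_eq_iff)
  define U where "U = matrix_inv N ** (mat 1 - Y ** X)"
  define T where "T = T_mat X U"
  define E where "E = E_mat Y N"
  have U: "invertible U"
    unfolding U_def by (intro invertible_mult invertible_matrix_inv F_G_pd_invertible G N)
  have "N ** U = mat 1 - Y ** X"
    by (simp add: U_def matrix_mul_assoc matrix_inv_mult[OF N])
  then have YX: "Y ** X + N ** U = mat 1" by simp
  have TE: "transpose T ** E = F_G X Y"
    unfolding T_def E_def by (rule T_transpose_E[OF YX X Y])
  note tr = closed_loop_transform[OF K Y lift_policy_of[OF \<Lambda> N G, folded U_def, symmetric],
      folded T_def E_def]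
  have Tinv: "invertible T"
  proof (rule invertible_if_kernel_trivial)
    fix z assume "T *v z = 0"
    moreover obtain x y where z: "z = vjoin x y" by (rule vjoin_cases)
    ultimately have *: "X *v x + y = 0" "U *v x = 0"
      by (simp_all add: T_def T_mat_def block2_vjoin vjoin_eq_0_iff)
    have "matrix_inv U *v (U *v x) = x"
      by (simp add: matrix_vector_mul_assoc matrix_inv_mult[OF U])
    then have "x = 0" using * by simp
    then show "z = 0" using * by (simp add: z vjoin_eq_0_iff)
  qed
  define Ti where "Ti = matrix_inv T"
  have TTi: "T ** Ti = mat 1" and TiT: "Ti ** T = mat 1"
    by (simp_all add: Ti_def matrix_inv_mult[OF Tinv])
  define P where "P = transpose Ti ** F_G X Y ** Ti"
  have TiE: "transpose Ti ** transpose T = mat 1"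
    by (simp add: TTi flip: matrix_transpose_mul)
  have P: "pd P"
    unfolding P_def
  proof (rule pd_congruence[OF G])
    fix x assume "Ti *v x = 0"
    then have "T *v (Ti *v x) = 0" by simp
    then show "x = 0" by (simp add: matrix_vector_mul_assoc TTi)
  qed
  have Ptr: "transpose P = P" using P by (simp add: pd_def)
  have PT: "P ** T = E"
  proof -
    have "P ** T = (transpose Ti ** transpose T) ** E ** (Ti ** T)"
      unfolding P_def TE[symmetric] by (simp only: matrix_mul_assoc)
    then show ?thesis by (simp add: TiE TiT)
  qed
  have TP: "transpose E = transpose T ** P"
    using arg_cong[OF PT, of transpose] Ptr by (simp add: matrix_transpose_mul)
  have PA: "transpose Ti ** F_Phi A B C \<Lambda> X Y ** Ti = P ** Acl A B C ?K"
  proof -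
    have "transpose Ti ** F_Phi A B C \<Lambda> X Y ** Ti
        = (transpose Ti ** transpose T) ** P ** Acl A B C ?K ** (T ** Ti)"
      unfolding tr(1)[symmetric] TP by (simp only: matrix_mul_assoc)
    then show ?thesis by (simp add: TiE TTi)
  qed
  have PB: "transpose Ti ** F_Psi W V \<Lambda> Y = P ** Bcl B W V ?K"
  proof -
    have "transpose Ti ** F_Psi W V \<Lambda> Y = (transpose Ti ** transpose T) ** P ** Bcl B W V ?K"
      unfolding tr(2)[symmetric] TP by (simp only: matrix_mul_assoc)
    then show ?thesis by (simp add: TiE)
  qed
  have PC: "F_Theta Q R \<Lambda> X ** Ti = Ccl C Q R ?K"
  proof -
    have "F_Theta Q R \<Lambda> X ** Ti = Ccl C Q R ?K ** (T ** Ti)"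
      unfolding tr(3)[symmetric] by (simp only: matrix_mul_assoc)
    then show ?thesis by (simp add: TTi)
  qed
  have hur: "hurwitz (Acl A B C ?K)"
  proof (rule hurwitz_if_lyapunov[OF P])
    fix x :: "real^('a + 'a)" assume "x \<noteq> 0"
    have "Ti *v x \<noteq> 0"
      using \<open>x \<noteq> 0\<close> by (metis TTi matrix_vector_mul_assoc matrix_vector_mul_lid matrix_vector_mult_0_right)
    have "x \<bullet> (P *v (Acl A B C ?K *v x)) = (Ti *v x) \<bullet> (F_Phi A B C \<Lambda> X Y *v (Ti *v x))"
      unfolding matrix_vector_mul_assoc PA[symmetric]
      by (simp add: inner_transpose' inner_commute flip: matrix_vector_mul_assoc)
    then show "x \<bullet> (P *v (Acl A B C ?K *v x)) < 0"
      using neg[OF \<open>Ti *v x \<noteq> 0\<close>] by simp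
  qed
  then show "?K \<in> stabilizing A B C"
    using K by (simp add: stabilizing_def)
  show "J_LQG A B C Q R W V ?K \<le> \<gamma>"
    unfolding J_LQG_eq[OF K]
  proof (rule h2_norm_le_if_lmi[OF hur P \<Gamma>(2,1)])
    show "lyap_lmi (P ** Acl A B C ?K) (P ** Bcl B W V ?K) \<gamma>"
      using lyap_lmi_congruence[OF lmi1, of Ti] unfolding PA PB .
    show "out_lmi P (Ccl C Q R ?K) \<Gamma>"
      using out_lmi_congruence[OF lmi2, of Ti] unfolding PC P_def .
  qed
qed

section \<open>Convexity\<close>

lemma lyap_lmi_combine:
  assumes "lyap_lmi \<Phi>0 \<Psi>0 \<gamma>0" "lyap_lmi \<Phi>1 \<Psi>1 \<gamma>1" "0 \<le> s" "0 \<le> t"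
  shows "lyap_lmi (s *\<^sub>R \<Phi>0 + t *\<^sub>R \<Phi>1) (s *\<^sub>R \<Psi>0 + t *\<^sub>R \<Psi>1) (s * \<gamma>0 + t * \<gamma>1)"
  unfolding lyap_lmi_def
proof (intro allI)
  fix x y
  have "s * (2 * (x \<bullet> (\<Phi>0 *v x)) + 2 * (x \<bullet> (\<Psi>0 *v y))) + t * (2 * (x \<bullet> (\<Phi>1 *v x)) + 2 * (x \<bullet> (\<Psi>1 *v y)))
      \<le> s * (\<gamma>0 * (y \<bullet> y)) + t * (\<gamma>1 * (y \<bullet> y))"
    using assms unfolding lyap_lmi_def by (intro add_mono mult_left_mono) auto
  then show "2 * (x \<bullet> ((s *\<^sub>R \<Phi>0 + t *\<^sub>R \<Phi>1) *v x)) + 2 * (x \<bullet> ((s *\<^sub>R \<Psi>0 + t *\<^sub>R \<Psi>1) *v y))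
      \<le> (s * \<gamma>0 + t * \<gamma>1) * (y \<bullet> y)"
    by (simp add: matrix_vector_mult_add_rdistrib inner_add_right algebra_simps
        flip: scaleR_matrix_vector_assoc)
qed

lemma out_lmi_combine:
  assumes "out_lmi G0 \<Theta>0 \<Gamma>0" "out_lmi G1 \<Theta>1 \<Gamma>1" "0 \<le> s" "0 \<le> t"
  shows "out_lmi (s *\<^sub>R G0 + t *\<^sub>R G1) (s *\<^sub>R \<Theta>0 + t *\<^sub>R \<Theta>1) (s *\<^sub>R \<Gamma>0 + t *\<^sub>R \<Gamma>1)"
  unfolding out_lmi_def
proof (intro conjI allI)
  fix x y
  have "0 \<le> s * (x \<bullet> (G0 *v x) + 2 * ((\<Theta>0 *v x) \<bullet> y) + y \<bullet> (\<Gamma>0 *v y))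
      + t * (x \<bullet> (G1 *v x) + 2 * ((\<Theta>1 *v x) \<bullet> y) + y \<bullet> (\<Gamma>1 *v y))"
    using assms unfolding out_lmi_def
    by (intro add_nonneg_nonneg[OF mult_nonneg_nonneg mult_nonneg_nonneg]) auto
  then show "0 \<le> x \<bullet> ((s *\<^sub>R G0 + t *\<^sub>R G1) *v x) + 2 * (((s *\<^sub>R \<Theta>0 + t *\<^sub>R \<Theta>1) *v x) \<bullet> y)
      + y \<bullet> ((s *\<^sub>R \<Gamma>0 + t *\<^sub>R \<Gamma>1) *v y)"
    by (simp add: matrix_vector_mult_add_rdistrib inner_add_right inner_add_left algebra_simps
        flip: scaleR_matrix_vector_assoc)
qed (use assms in \<open>auto simp: out_lmi_def transpose_distribs\<close>)

lemma F_coefficients_affine: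
  assumes "s + t = (1::real)"
  shows "F_Phi A B C (s *\<^sub>R \<Lambda>0 + t *\<^sub>R \<Lambda>1) (s *\<^sub>R X0 + t *\<^sub>R X1) (s *\<^sub>R Y0 + t *\<^sub>R Y1)
      = s *\<^sub>R F_Phi A B C \<Lambda>0 X0 Y0 + t *\<^sub>R F_Phi A B C \<Lambda>1 X1 Y1"
    and "F_Psi W V (s *\<^sub>R \<Lambda>0 + t *\<^sub>R \<Lambda>1) (s *\<^sub>R Y0 + t *\<^sub>R Y1)
      = s *\<^sub>R F_Psi W V \<Lambda>0 Y0 + t *\<^sub>R F_Psi W V \<Lambda>1 Y1"
    and "F_Theta Q R (s *\<^sub>R \<Lambda>0 + t *\<^sub>R \<Lambda>1) (s *\<^sub>R X0 + t *\<^sub>R X1)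
      = s *\<^sub>R F_Theta Q R \<Lambda>0 X0 + t *\<^sub>R F_Theta Q R \<Lambda>1 X1"
    and "F_G (s *\<^sub>R X0 + t *\<^sub>R X1) (s *\<^sub>R Y0 + t *\<^sub>R Y1)
      = s *\<^sub>R F_G X0 Y0 + t *\<^sub>R F_G X1 Y1"
proof -
  have c: "s *\<^sub>R M + t *\<^sub>R M = M" for M :: "'z::real_vector"
    using assms(1) by (simp flip: scaleR_left_distrib)
  note ds = block2_scaleR block2_add blk_add blk_scaleR mat_distribs
    scaleR_add_right vcat_scaleR vcat_add hcat_scaleR hcat_add c
  show "F_Phi A B C (s *\<^sub>R \<Lambda>0 + t *\<^sub>R \<Lambda>1) (s *\<^sub>R X0 + t *\<^sub>R X1) (s *\<^sub>R Y0 + t *\<^sub>R Y1)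
      = s *\<^sub>R F_Phi A B C \<Lambda>0 X0 Y0 + t *\<^sub>R F_Phi A B C \<Lambda>1 X1 Y1"
    unfolding F_Phi_def ds by (simp add: add_ac)
  show "F_Psi W V (s *\<^sub>R \<Lambda>0 + t *\<^sub>R \<Lambda>1) (s *\<^sub>R Y0 + t *\<^sub>R Y1)
      = s *\<^sub>R F_Psi W V \<Lambda>0 Y0 + t *\<^sub>R F_Psi W V \<Lambda>1 Y1"
    unfolding F_Psi_def ds by (simp add: add_ac)
  show "F_Theta Q R (s *\<^sub>R \<Lambda>0 + t *\<^sub>R \<Lambda>1) (s *\<^sub>R X0 + t *\<^sub>R X1)
      = s *\<^sub>R F_Theta Q R \<Lambda>0 X0 + t *\<^sub>R F_Theta Q R \<Lambda>1 X1"
    unfolding F_Theta_def ds by (simp add: add_ac)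
  show "F_G (s *\<^sub>R X0 + t *\<^sub>R X1) (s *\<^sub>R Y0 + t *\<^sub>R Y1)
      = s *\<^sub>R F_G X0 Y0 + t *\<^sub>R F_G X1 Y1"
    unfolding F_G_def ds ..
qed

lemma relaxed_point_combine:
  assumes "relaxed_point A B C Q R W V \<gamma>0 \<Lambda>0 X0 Y0 \<Gamma>0" "relaxed_point A B C Q R W V \<gamma>1 \<Lambda>1 X1 Y1 \<Gamma>1"
    and st: "0 \<le> s" "0 \<le> t" "s + t = 1"
  shows "relaxed_point A B C Q R W V (s * \<gamma>0 + t * \<gamma>1) (s *\<^sub>R \<Lambda>0 + t *\<^sub>R \<Lambda>1)
    (s *\<^sub>R X0 + t *\<^sub>R X1) (s *\<^sub>R Y0 + t *\<^sub>R Y1) (s *\<^sub>R \<Gamma>0 + t *\<^sub>R \<Gamma>1)"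
  unfolding relaxed_point_def F_coefficients_affine[OF st(3)]
  using assms
  by (auto simp: relaxed_point_def policy_space_def DK_def blk_add blk_scaleR trace_add trace_scaleR
      intro!: psd_add psd_scaleR lyap_lmi_combine out_lmi_combine add_mono mult_left_mono)

lemma lyap_lmi_nonpos:
  assumes "lyap_lmi \<Phi> \<Psi> \<gamma>" shows "x \<bullet> (\<Phi> *v x) \<le> 0"
  using assms[unfolded lyap_lmi_def, rule_format, of x 0] by simp

lemma relaxed_pointD:
  assumes "relaxed_point A B C Q R W V \<gamma> \<Lambda> X Y \<Gamma>"
  shows "0 \<le> \<gamma>" "psd (F_G X Y)" "x \<bullet> (F_Phi A B C \<Lambda> X Y *v x) \<le> 0"
proof -
  show "0 \<le> \<gamma>" using assms trace_psd by (force simp: relaxed_point_def)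
  have "out_lmi (F_G X Y) (F_Theta Q R \<Lambda> X) \<Gamma>" using assms by (simp add: relaxed_point_def)
  then show "psd (F_G X Y)"
    unfolding out_lmi_def psd_def
    by (metis add.right_neutral inner_zero_left inner_zero_right mult_zero_right)
  have "lyap_lmi (F_Phi A B C \<Lambda> X Y) (F_Psi W V \<Lambda> Y) \<gamma>" using assms by (simp add: relaxed_point_def)
  then show "x \<bullet> (F_Phi A B C \<Lambda> X Y *v x) \<le> 0" by (rule lyap_lmi_nonpos)
qed

text \<open>Mixing with a strict point repairs every defect of a relaxed point, at an arbitrarily small cost
  in \<open>\<gamma>\<close>.\<close>

lemma strict_point_combine:
  assumes r: "relaxed_point A B C Q R W V \<gamma>0 \<Lambda>0 X0 Y0 \<Gamma>0" and st1: "strict_point A B C Q R W V \<gamma>1 \<Lambda>1 X1 Y1 \<Gamma>1"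
    and st: "0 \<le> s" "0 < t" "s + t = 1"
  shows "strict_point A B C Q R W V (s * \<gamma>0 + t * \<gamma>1) (s *\<^sub>R \<Lambda>0 + t *\<^sub>R \<Lambda>1)
    (s *\<^sub>R X0 + t *\<^sub>R X1) (s *\<^sub>R Y0 + t *\<^sub>R Y1) (s *\<^sub>R \<Gamma>0 + t *\<^sub>R \<Gamma>1)"
proof -
  have r1: "relaxed_point A B C Q R W V \<gamma>1 \<Lambda>1 X1 Y1 \<Gamma>1" and G1: "pd (F_G X1 Y1)" and g1: "0 < \<gamma>1"
    and n1: "\<And>x. x \<noteq> 0 \<Longrightarrow> x \<bullet> (F_Phi A B C \<Lambda>1 X1 Y1 *v x) < 0"
    using st1 by (auto simp: strict_point_def)
  note d = relaxed_pointD[OF r]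
  show ?thesis
    unfolding strict_point_def F_coefficients_affine[OF st(3)]
  proof (intro conjI allI impI)
    show "relaxed_point A B C Q R W V (s * \<gamma>0 + t * \<gamma>1) (s *\<^sub>R \<Lambda>0 + t *\<^sub>R \<Lambda>1)
      (s *\<^sub>R X0 + t *\<^sub>R X1) (s *\<^sub>R Y0 + t *\<^sub>R Y1) (s *\<^sub>R \<Gamma>0 + t *\<^sub>R \<Gamma>1)"
      using st by (intro relaxed_point_combine r r1) auto
    show "pd (s *\<^sub>R F_G X0 Y0 + t *\<^sub>R F_G X1 Y1)"
      unfolding add.commute[of "s *\<^sub>R F_G X0 Y0"]
      by (intro pd_add_psd pd_scaleR psd_scaleR G1 d st)
    show "0 < s * \<gamma>0 + t * \<gamma>1" using d(1) g1 st by (simp add: add_nonneg_pos)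
    fix x :: "real^('a + 'a)" assume "x \<noteq> 0"
    have "s * (x \<bullet> (F_Phi A B C \<Lambda>0 X0 Y0 *v x)) \<le> 0" "t * (x \<bullet> (F_Phi A B C \<Lambda>1 X1 Y1 *v x)) < 0"
      using st d(3) n1[OF \<open>x \<noteq> 0\<close>] by (simp_all add: mult_nonneg_nonpos mult_pos_neg)
    then show "x \<bullet> ((s *\<^sub>R F_Phi A B C \<Lambda>0 X0 Y0 + t *\<^sub>R F_Phi A B C \<Lambda>1 X1 Y1) *v x) < 0"
      by (simp add: matrix_vector_mult_add_rdistrib inner_add_right flip: scaleR_matrix_vector_assoc)
  qed
qed

lemma convex_F_LQG: "convex (F_LQG A B C Q R W V)"
proof (rule convexI)
  fix z0 z1 :: "real \<times> (real^('a + 'b)^('c + 'b)) \<times> (real^'b^'b) \<times> (real^'b^'b) \<times> (real^('b + 'c)^('b + 'c))"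
    and s t :: real
  assume z: "z0 \<in> F_LQG A B C Q R W V" "z1 \<in> F_LQG A B C Q R W V" and st: "0 \<le> s" "0 \<le> t" "s + t = 1"
  obtain \<gamma>0 \<Lambda>0 X0 Y0 \<Gamma>0 where z0: "z0 = (\<gamma>0, \<Lambda>0, X0, Y0, \<Gamma>0)" by (cases z0)
  obtain \<gamma>1 \<Lambda>1 X1 Y1 \<Gamma>1 where z1: "z1 = (\<gamma>1, \<Lambda>1, X1, Y1, \<Gamma>1)" by (cases z1)
  have r: "relaxed_point A B C Q R W V \<gamma>0 \<Lambda>0 X0 Y0 \<Gamma>0" "relaxed_point A B C Q R W V \<gamma>1 \<Lambda>1 X1 Y1 \<Gamma>1"
    and G: "pd (F_G X0 Y0)" "pd (F_G X1 Y1)"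
    using z by (auto simp: z0 z1 F_LQG_iff)
  have "pd (s *\<^sub>R F_G X0 Y0 + t *\<^sub>R F_G X1 Y1)"
  proof (cases "s = 0")
    case False
    then show ?thesis using st G by (intro pd_add_psd pd_scaleR psd_scaleR pd_imp_psd) auto
  qed (use st G in simp)
  then show "s *\<^sub>R z0 + t *\<^sub>R z1 \<in> F_LQG A B C Q R W V"
    using relaxed_point_combine[OF r st]
    by (simp add: z0 z1 F_LQG_iff F_coefficients_affine(4)[OF st(3)])
qed

section \<open>A strictly feasible point\<close>

lemma pd_dominates_bilinear:
  fixes D :: "real^'n^'n" and N :: "real^'k^'n"
  assumes "pd D"
  obtains g where "0 < g" "\<And>\<gamma> x y. g \<le> \<gamma> \<Longrightarrow> 2 * (x \<bullet> (N *v y)) \<le> x \<bullet> (D *v x) + \<gamma> * (y \<bullet> y)"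
proof -
  obtain c where c: "0 < c" "\<And>x. c * (x \<bullet> x) \<le> x \<bullet> (D *v x)"
    using pd_coercive[OF assms] by blast
  obtain k where k: "0 < k" "\<And>y. norm (N *v y) \<le> norm y * k"
    using bounded_linear.pos_bounded[OF matrix_vector_mul_bounded_linear[of N]] by blast
  show thesis
  proof
    show "0 < k\<^sup>2 / c" using c k by simp
    fix \<gamma> :: real and x y assume \<gamma>: "k\<^sup>2 / c \<le> \<gamma>"
    have "x \<bullet> (N *v y) \<le> norm x * norm (N *v y)"
      by (rule norm_cauchy_schwarz)
    also have "\<dots> \<le> norm x * (norm y * k)" by (intro mult_left_mono k) simp
    finally have "2 * (x \<bullet> (N *v y)) \<le> 2 * (norm x * (k * norm y))" by (simp add: mult_ac)
    also have "\<dots> \<le> c * (norm x)\<^sup>2 + (k\<^sup>2 / c) * (norm y)\<^sup>2"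
    proof -
      have "0 \<le> (c * norm x - k * norm y)\<^sup>2 / c" using c by simp
      also have "\<dots> = c * (norm x)\<^sup>2 + (k\<^sup>2 / c) * (norm y)\<^sup>2 - 2 * (norm x * (k * norm y))"
        using c by (simp add: power2_eq_square field_simps)
      finally show ?thesis by simp
    qed
    also have "\<dots> \<le> x \<bullet> (D *v x) + \<gamma> * (y \<bullet> y)"
      unfolding dot_square_norm[symmetric] by (intro add_mono c mult_right_mono \<gamma>) simp
    finally show "2 * (x \<bullet> (N *v y)) \<le> x \<bullet> (D *v x) + \<gamma> * (y \<bullet> y)" .
  qed
qed

lemma pd_block2_diag:
  assumes "pd D1" "pd D2"
  shows "pd (block2 D1 0 0 D2)"
proof -
  have "0 < vjoin x y \<bullet> (block2 D1 0 0 D2 *v vjoin x y)" if "vjoin x y \<noteq> 0" for x y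
  proof -
    have "0 \<le> x \<bullet> (D1 *v x)" "0 \<le> y \<bullet> (D2 *v y)" "0 < x \<bullet> (D1 *v x) \<or> 0 < y \<bullet> (D2 *v y)"
      using assms[THEN pd_imp_psd] assms that by (auto simp: pd_def psd_def vjoin_eq_0_iff)
    then show ?thesis
      by (auto simp: block2_vjoin inner_vjoin add_pos_nonneg add_nonneg_pos)
  qed
  moreover have "transpose (block2 D1 0 0 D2) = block2 D1 0 0 D2"
    using assms by (simp add: transpose_block2 pd_def)
  ultimately show ?thesis
    unfolding pd_def by (metis vjoin_cases)
qed

lemma F_G_pd_scaled:
  assumes "pd Z1" "pd Z2"
  obtains \<kappa> where "0 < \<kappa>" "pd (F_G (\<kappa> *\<^sub>R Z1) (\<kappa> *\<^sub>R Z2))"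
proof -
  obtain c1 where c1: "0 < c1" "\<And>x. c1 * (x \<bullet> x) \<le> x \<bullet> (Z1 *v x)"
    using pd_coercive[OF assms(1)] by blast
  obtain c2 where c2: "0 < c2" "\<And>x. c2 * (x \<bullet> x) \<le> x \<bullet> (Z2 *v x)"
    using pd_coercive[OF assms(2)] by blast
  \<comment> \<open>Large enough for \<open>\<kappa>Z\<^sub>i \<succeq> 2I\<close>, which dominates the off-diagonal identity blocks.\<close>
  define \<kappa> where "\<kappa> = 2 / c1 + 2 / c2"
  have \<kappa>: "0 < \<kappa>" "2 \<le> \<kappa> * c1" "2 \<le> \<kappa> * c2"
    using c1(1) c2(1) by (simp_all add: \<kappa>_def field_simps)
  have "0 < vjoin x y \<bullet> (F_G (\<kappa> *\<^sub>R Z1) (\<kappa> *\<^sub>R Z2) *v vjoin x y)" if "vjoin x y \<noteq> 0" for x y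
  proof -
    have "2 * (x \<bullet> x) \<le> \<kappa> * c1 * (x \<bullet> x)" by (intro mult_right_mono \<kappa>) simp
    also have "\<dots> \<le> \<kappa> * (x \<bullet> (Z1 *v x))" using c1(2)[of x] \<kappa>(1) by (simp add: mult.assoc)
    finally have 1: "2 * (x \<bullet> x) \<le> \<kappa> * (x \<bullet> (Z1 *v x))" .
    have "2 * (y \<bullet> y) \<le> \<kappa> * c2 * (y \<bullet> y)" by (intro mult_right_mono \<kappa>) simp
    also have "\<dots> \<le> \<kappa> * (y \<bullet> (Z2 *v y))" using c2(2)[of y] \<kappa>(1) by (simp add: mult.assoc)
    finally have 2: "2 * (y \<bullet> y) \<le> \<kappa> * (y \<bullet> (Z2 *v y))" .
    have "0 \<le> (x + y) \<bullet> (x + y)" by simp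
    then have 3: "0 \<le> x \<bullet> x + 2 * (x \<bullet> y) + y \<bullet> y"
      by (simp add: inner_add_left inner_add_right inner_commute)
    have 4: "0 < x \<bullet> x + y \<bullet> y"
      using that by (auto simp: vjoin_eq_0_iff add_pos_nonneg add_nonneg_pos)
    have "vjoin x y \<bullet> (F_G (\<kappa> *\<^sub>R Z1) (\<kappa> *\<^sub>R Z2) *v vjoin x y)
        = \<kappa> * (x \<bullet> (Z1 *v x)) + 2 * (x \<bullet> y) + \<kappa> * (y \<bullet> (Z2 *v y))"
      by (simp add: F_G_def block2_vjoin inner_vjoin inner_add_right inner_commute
          flip: scaleR_matrix_vector_assoc)
    then show ?thesis using 1 2 3 4 by linarith
  qed
  moreover have "transpose (F_G (\<kappa> *\<^sub>R Z1) (\<kappa> *\<^sub>R Z2)) = F_G (\<kappa> *\<^sub>R Z1) (\<kappa> *\<^sub>R Z2)"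
    using assms by (simp add: F_G_def transpose_block2 transpose_scalar pd_def)
  ultimately have "pd (F_G (\<kappa> *\<^sub>R Z1) (\<kappa> *\<^sub>R Z2))"
    unfolding pd_def by (subst forall_vjoin) auto
  then show thesis using that \<kappa>(1) by blast
qed

text \<open>The shifted Gramians of \<open>(A, B)\<close> and of the dual pair \<open>(A\<^sup>T, C\<^sup>T)\<close> serve as \<open>X\<close> and \<open>Y\<close>, up to scaling.\<close>

lemma strict_point_exists:
  fixes A :: "real^'n^'n" and B :: "real^'m^'n" and C :: "real^'n^'p"
    and Q W :: "real^'n^'n" and R :: "real^'m^'m" and V :: "real^'p^'p"
  assumes "controllable A B" "observable C A"
  obtains \<gamma> \<Lambda> X Y \<Gamma> where "strict_point A B C Q R W V \<gamma> \<Lambda> X Y \<Gamma>"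
proof -
  obtain Z1 b1 where Z1: "pd Z1" "0 < b1" "A ** Z1 + Z1 ** transpose A - 2 *\<^sub>R (B ** transpose B) = - (b1 *\<^sub>R Z1)"
    using bass_gramian[OF assms(1)] by blast
  obtain Z2 b2 where Z2: "pd Z2" "0 < b2"
    "transpose A ** Z2 + Z2 ** A - 2 *\<^sub>R (transpose C ** C) = - (b2 *\<^sub>R Z2)"
    using bass_gramian[OF controllable_transpose[OF assms(2)]] by auto
  obtain \<kappa> where \<kappa>: "0 < \<kappa>" "pd (F_G (\<kappa> *\<^sub>R Z1) (\<kappa> *\<^sub>R Z2))"
    using F_G_pd_scaled[OF Z1(1) Z2(1)] by blast
  define X where "X = \<kappa> *\<^sub>R Z1"
  define Y where "Y = \<kappa> *\<^sub>R Z2"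
  \<comment> \<open>\<open>M = -A\<^sup>T\<close> cancels the off-diagonal blocks of \<open>\<Phi> + \<Phi>\<^sup>T\<close>.\<close>
  define \<Lambda> :: "real^('p + 'n)^('m + 'n)"
    where "\<Lambda> = block2 0 (- \<kappa> *\<^sub>R transpose B) (- \<kappa> *\<^sub>R transpose C) (- transpose A)"
  define D where "D = block2 ((\<kappa> * b1 / 2) *\<^sub>R Z1) 0 0 ((\<kappa> * b2 / 2) *\<^sub>R Z2)"
  have D: "pd D" unfolding D_def using \<kappa> Z1 Z2 by (intro pd_block2_diag pd_scaleR) auto
  have \<Phi>: "x \<bullet> (F_Phi A B C \<Lambda> X Y *v x) = - (x \<bullet> (D *v x))" for x
  proof -
    have sum: "F_Phi A B C \<Lambda> X Y + transpose (F_Phi A B C \<Lambda> X Y) = - (2 *\<^sub>R D)"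
    proof -
      have "A ** X + B ** (- \<kappa> *\<^sub>R transpose B) + transpose (A ** X + B ** (- \<kappa> *\<^sub>R transpose B))
          = \<kappa> *\<^sub>R (A ** Z1 + Z1 ** transpose A - 2 *\<^sub>R (B ** transpose B))"
        using Z1(1) by (simp add: X_def pd_def transpose_distribs mat_distribs scaleR_add_right
            scaleR_diff_right scaleR_2)
      moreover have "Y ** A + (- \<kappa> *\<^sub>R transpose C) ** C + transpose (Y ** A + (- \<kappa> *\<^sub>R transpose C) ** C)
          = \<kappa> *\<^sub>R (transpose A ** Z2 + Z2 ** A - 2 *\<^sub>R (transpose C ** C))"
        using Z2(1) by (simp add: Y_def pd_def transpose_distribs mat_distribs scaleR_add_right
            scaleR_diff_right scaleR_2)
      ultimately show ?thesis
        unfolding Z1(3) Z2(3)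
        by (simp add: F_Phi_def \<Lambda>_def D_def transpose_block2 block2_add block2_scaleR block2_minus
            transpose_minus block2_eq_iff)
    qed
    have "x \<bullet> (F_Phi A B C \<Lambda> X Y *v x) + x \<bullet> (transpose (F_Phi A B C \<Lambda> X Y) *v x) = - (2 * (x \<bullet> (D *v x)))"
      using arg_cong[OF sum, of "\<lambda>M. x \<bullet> (M *v x)"]
      by (simp add: matrix_vector_mult_add_rdistrib inner_add_right matrix_vector_minus_left
          flip: scaleR_matrix_vector_assoc)
    then show ?thesis by (simp add: inner_transpose')
  qed
  obtain g1 where g1: "0 < g1"
    "\<And>\<gamma> x y. g1 \<le> \<gamma> \<Longrightarrow> 2 * (x \<bullet> (F_Psi W V \<Lambda> Y *v y)) \<le> x \<bullet> (D *v x) + \<gamma> * (y \<bullet> y)"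
    using pd_dominates_bilinear[OF D] by blast
  have G: "pd (F_G X Y)" using \<kappa> by (simp add: X_def Y_def)
  obtain g2 where g2: "0 < g2"
    "\<And>\<gamma> x y. g2 \<le> \<gamma> \<Longrightarrow> 2 * (x \<bullet> (- transpose (F_Theta Q R \<Lambda> X) *v y)) \<le> x \<bullet> (F_G X Y *v x) + \<gamma> * (y \<bullet> y)"
    using pd_dominates_bilinear[OF G] by blast
  define \<Gamma> :: "real^('n + 'm)^('n + 'm)" where "\<Gamma> = mat g2"
  define \<gamma> where "\<gamma> = max g1 (trace \<Gamma>)"
  have "relaxed_point A B C Q R W V \<gamma> \<Lambda> X Y \<Gamma>"
    unfolding relaxed_point_def
  proof (intro conjI)
    show "\<Lambda> \<in> policy_space" by (simp add: \<Lambda>_def policy_space_def DK_def)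
    show "psd \<Gamma>" using g2(1) by (simp add: \<Gamma>_def psd_def mat_vector)
    show "trace \<Gamma> \<le> \<gamma>" by (simp add: \<gamma>_def)
    show "lyap_lmi (F_Phi A B C \<Lambda> X Y) (F_Psi W V \<Lambda> Y) \<gamma>"
      unfolding lyap_lmi_def \<Phi>
    proof (intro allI)
      fix x y
      have "2 * (x \<bullet> (F_Psi W V \<Lambda> Y *v y)) \<le> x \<bullet> (D *v x) + \<gamma> * (y \<bullet> y)"
        by (rule g1(2)) (simp add: \<gamma>_def)
      moreover have "0 \<le> x \<bullet> (D *v x)" using pd_imp_psd[OF D] by (simp add: psd_def)
      ultimately show "2 * - (x \<bullet> (D *v x)) + 2 * (x \<bullet> (F_Psi W V \<Lambda> Y *v y)) \<le> \<gamma> * (y \<bullet> y)"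
        by linarith
    qed
    show "out_lmi (F_G X Y) (F_Theta Q R \<Lambda> X) \<Gamma>"
      unfolding out_lmi_def
    proof (intro conjI allI)
      show "transpose (F_G X Y) = F_G X Y" using G by (simp add: pd_def)
      fix x y
      have "2 * (x \<bullet> (- transpose (F_Theta Q R \<Lambda> X) *v y)) \<le> x \<bullet> (F_G X Y *v x) + g2 * (y \<bullet> y)"
        by (rule g2(2)) simp
      then show "0 \<le> x \<bullet> (F_G X Y *v x) + 2 * ((F_Theta Q R \<Lambda> X *v x) \<bullet> y) + y \<bullet> (\<Gamma> *v y)"
        by (simp add: \<Gamma>_def mat_vector matrix_vector_minus_left inner_transpose' inner_commute)
    qed (simp add: \<Gamma>_def)
  qed
  moreover have "x \<bullet> (F_Phi A B C \<Lambda> X Y *v x) < 0" if "x \<noteq> 0" for x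
    using D that by (simp add: \<Phi> pd_def)
  ultimately have "strict_point A B C Q R W V \<gamma> \<Lambda> X Y \<Gamma>"
    using G g1(1) by (simp add: strict_point_def \<gamma>_def)
  then show thesis by (rule that)
qed

section \<open>First-order variation of the reconstructed policy\<close>

text \<open>Curves that are Lipschitz at \<open>0\<close> from the right. This suffices for the first-order argument
  below, so that derivatives of matrix inverses are not needed.\<close>

definition lip0 :: "(real \<Rightarrow> 'a::real_normed_vector) \<Rightarrow> bool" where
  "lip0 f \<longleftrightarrow> (\<exists>c\<ge>0. \<forall>\<^sub>F t in at_right 0. norm (f t - f 0) \<le> c * t)"

lemma at_right_0_pos: "\<forall>\<^sub>F t in at_right (0::real). 0 < t"
  by (rule eventually_at_right_less)

lemma at_right_0_less: "0 < a \<Longrightarrow> \<forall>\<^sub>F t in at_right (0::real). t < a"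
  using eventually_at_right_field by blast

lemma lip0_const: "lip0 (\<lambda>t. a)"
  unfolding lip0_def by (intro exI[of _ 0]) simp

lemma lip0_segment: "lip0 (\<lambda>t. (1 - t) *\<^sub>R a + t *\<^sub>R b)"
  unfolding lip0_def
proof (intro exI[of _ "norm (b - a)"] conjI)
  show "\<forall>\<^sub>F t in at_right 0. norm ((1 - t) *\<^sub>R a + t *\<^sub>R b - ((1 - 0) *\<^sub>R a + 0 *\<^sub>R b)) \<le> norm (b - a) * t"
    using at_right_0_pos
  proof eventually_elim
    case (elim t)
    have "(1 - t) *\<^sub>R a + t *\<^sub>R b - ((1 - 0) *\<^sub>R a + 0 *\<^sub>R b) = t *\<^sub>R (b - a)"
      by (simp add: algebra_simps)
    then show ?case using elim by simp
  qed
qed simp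

lemma lip0_diff:
  assumes "lip0 f" "lip0 g" shows "lip0 (\<lambda>t. f t - g t)"
proof -
  obtain c1 c2 where c: "0 \<le> c1" "0 \<le> c2" "\<forall>\<^sub>F t in at_right 0. norm (f t - f 0) \<le> c1 * t"
    "\<forall>\<^sub>F t in at_right 0. norm (g t - g 0) \<le> c2 * t"
    using assms unfolding lip0_def by blast
  have "\<forall>\<^sub>F t in at_right 0. norm ((f t - g t) - (f 0 - g 0)) \<le> (c1 + c2) * t"
    using c(3,4)
  proof eventually_elim
    case (elim t)
    have eq: "(f t - g t) - (f 0 - g 0) = (f t - f 0) - (g t - g 0)" by simp
    show ?case
      unfolding eq distrib_right
      using elim norm_triangle_ineq4[of "f t - f 0" "g t - g 0"] by linarith
  qed
  then show ?thesis unfolding lip0_def using c by (intro exI[of _ "c1 + c2"]) auto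
qed

lemma lip0_linear:
  fixes h :: "'a::euclidean_space \<Rightarrow> 'b::real_normed_vector"
  assumes "lip0 f" "linear h" shows "lip0 (\<lambda>t. h (f t))"
proof -
  obtain c where c: "0 \<le> c" "\<forall>\<^sub>F t in at_right 0. norm (f t - f 0) \<le> c * t"
    using assms unfolding lip0_def by blast
  obtain k where k: "0 < k" "\<And>x. norm (h x) \<le> norm x * k"
    using linear_bounded_pos[OF assms(2)] by (metis mult.commute)
  have "\<forall>\<^sub>F t in at_right 0. norm (h (f t) - h (f 0)) \<le> (c * k) * t"
    using c(2)
  proof eventually_elim
    case (elim t)
    have "norm (h (f t) - h (f 0)) = norm (h (f t - f 0))"
      by (simp add: linear_diff[OF assms(2)])
    also have "\<dots> \<le> norm (f t - f 0) * k" by (rule k)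
    also have "\<dots> \<le> c * t * k" using elim k(1) by (intro mult_right_mono) auto
    finally show ?case by (simp add: mult_ac)
  qed
  then show ?thesis unfolding lip0_def using c(1) k(1) by (intro exI[of _ "c * k"]) auto
qed

lemma lip0_add:
  assumes "lip0 f" "lip0 g" shows "lip0 (\<lambda>t. f t + g t)"
proof -
  obtain c1 c2 where c: "0 \<le> c1" "0 \<le> c2" "\<forall>\<^sub>F t in at_right 0. norm (f t - f 0) \<le> c1 * t"
    "\<forall>\<^sub>F t in at_right 0. norm (g t - g 0) \<le> c2 * t"
    using assms unfolding lip0_def by blast
  have "\<forall>\<^sub>F t in at_right 0. norm ((f t + g t) - (f 0 + g 0)) \<le> (c1 + c2) * t"
    using c(3,4)
  proof eventually_elim
    case (elim t)
    then show ?case using norm_diff_triangle_ineq[of "f t" "g t" "f 0" "g 0"] by (simp add: distrib_right)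
  qed
  then show ?thesis unfolding lip0_def using c by (intro exI[of _ "c1 + c2"]) auto
qed

lemma lip0_mult:
  fixes f :: "real \<Rightarrow> real^'n^'m" and g :: "real \<Rightarrow> real^'k^'n"
  assumes "lip0 f" "lip0 g" shows "lip0 (\<lambda>t. f t ** g t)"
proof -
  obtain c1 c2 where c: "0 \<le> c1" "0 \<le> c2" "\<forall>\<^sub>F t in at_right 0. norm (f t - f 0) \<le> c1 * t"
    "\<forall>\<^sub>F t in at_right 0. norm (g t - g 0) \<le> c2 * t"
    using assms unfolding lip0_def by blast
  obtain K where K: "0 < K" "\<And>(M::real^'n^'m) (N::real^'k^'n). norm (M ** N) \<le> norm M * norm N * K"
    using bounded_bilinear.pos_bounded[OF bounded_bilinear_matrix_mult] by blast
  let ?c = "c1 * (norm (g 0) + c2) * K + norm (f 0) * c2 * K"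
  have "\<forall>\<^sub>F t in at_right 0. norm (f t ** g t - f 0 ** g 0) \<le> ?c * t"
    using c(3,4) at_right_0_pos at_right_0_less[OF zero_less_one]
  proof eventually_elim
    case (elim t)
    have "c2 * t \<le> c2" using elim c(2) by (simp add: mult_left_le)
    then have gt: "norm (g t) \<le> norm (g 0) + c2"
      using elim(2) norm_triangle_sub[of "g t" "g 0"] by linarith
    have "f t ** g t - f 0 ** g 0 = (f t - f 0) ** g t + f 0 ** (g t - g 0)"
      by (simp add: mat_distribs)
    also have "norm \<dots> \<le> norm (f t - f 0) * norm (g t) * K + norm (f 0) * norm (g t - g 0) * K"
      by (intro norm_triangle_mono K)
    also have "\<dots> \<le> (c1 * t) * (norm (g 0) + c2) * K + norm (f 0) * (c2 * t) * K"
      using elim gt K(1) c(1,2) by (intro add_mono mult_mono) auto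
    finally show ?case by (simp add: algebra_simps)
  qed
  moreover have "0 \<le> ?c" using c(1,2) K(1) by simp
  ultimately show ?thesis unfolding lip0_def by blast
qed

lemma lip0_matrix_inv:
  fixes f :: "real \<Rightarrow> real^'n^'n"
  assumes "lip0 f" and inv0: "invertible (f 0)" and inv: "\<forall>\<^sub>F t in at_right 0. invertible (f t)"
  shows "lip0 (\<lambda>t. matrix_inv (f t))"
proof -
  obtain c where c: "0 \<le> c" "\<forall>\<^sub>F t in at_right 0. norm (f t - f 0) \<le> c * t"
    using assms unfolding lip0_def by blast
  obtain K where K: "0 < K" "\<And>(M::real^'n^'n) (N::real^'n^'n). norm (M ** N) \<le> norm M * norm N * K"
    using bounded_bilinear.pos_bounded[OF bounded_bilinear_matrix_mult] by blast
  let ?V = "\<lambda>t. matrix_inv (f t)"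
  define a where "a = c * norm (?V 0) * K * K"
  have "0 \<le> a" using c K by (simp add: a_def)
  have "0 < 1 / (2 * a + 2)" using \<open>0 \<le> a\<close> by simp
  from at_right_0_less[OF this] c(2) inv at_right_0_pos
  have "\<forall>\<^sub>F t in at_right 0. norm (?V t - ?V 0) \<le> (2 * a * norm (?V 0)) * t"
  proof eventually_elim
    case (elim t)
    then have t: "0 < t" "t < 1 / (2 * a + 2)" and f: "norm (f t - f 0) \<le> c * t" and "invertible (f t)"
      by auto
    note i0 = matrix_inv_mult[OF inv0] and it = matrix_inv_mult[OF \<open>invertible (f t)\<close>]
    \<comment> \<open>The resolvent identity bounds the increment of the inverse in terms of itself; for small \<open>t\<close> it
      can be absorbed on the left.\<close>
    have "?V t - ?V 0 = - (?V t ** (f t - f 0) ** ?V 0)"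
      by (simp add: mat_distribs it) (simp add: i0 flip: matrix_mul_assoc)
    then have "norm (?V t - ?V 0) = norm (?V t ** (f t - f 0) ** ?V 0)"
      by (metis norm_minus_cancel)
    also have "\<dots> \<le> norm (?V t ** (f t - f 0)) * norm (?V 0) * K" by (rule K)
    also have "\<dots> \<le> (norm (?V t) * (c * t) * K) * norm (?V 0) * K"
    proof (intro mult_right_mono)
      have "norm (?V t ** (f t - f 0)) \<le> norm (?V t) * norm (f t - f 0) * K" by (rule K)
      also have "\<dots> \<le> norm (?V t) * (c * t) * K"
        using f K(1) by (intro mult_right_mono mult_left_mono) auto
      finally show "norm (?V t ** (f t - f 0)) \<le> norm (?V t) * (c * t) * K" .
    qed (use K in auto)
    also have "\<dots> = a * t * norm (?V t)" by (simp add: a_def mult_ac)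
    also have "\<dots> \<le> a * t * (norm (?V 0) + norm (?V t - ?V 0))"
      using \<open>0 \<le> a\<close> t norm_triangle_sub[of "?V t" "?V 0"] by (intro mult_left_mono) auto
    finally have 1: "norm (?V t - ?V 0) \<le> a * t * norm (?V 0) + (a * t) * norm (?V t - ?V 0)"
      by (simp add: distrib_left)
    have "a * t \<le> 1 / 2" using t \<open>0 \<le> a\<close> by (simp add: field_simps)
    then have "(a * t) * norm (?V t - ?V 0) \<le> 1 / 2 * norm (?V t - ?V 0)"
      by (intro mult_right_mono) auto
    then show ?case
      using 1 by (simp add: mult_ac)
  qed
  moreover have "0 \<le> 2 * a * norm (?V 0)" using \<open>0 \<le> a\<close> by simp
  ultimately show ?thesis unfolding lip0_def by blast
qed

lemma lip0_block2:
  fixes f :: "real \<Rightarrow> real^'p^'r" and g :: "real \<Rightarrow> real^'q^'r"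
    and h :: "real \<Rightarrow> real^'p^'s" and k :: "real \<Rightarrow> real^'q^'s"
  assumes "lip0 f" "lip0 g" "lip0 h" "lip0 k"
  shows "lip0 (\<lambda>t. block2 (f t) (g t) (h t) (k t))"
proof -
  have "lip0 (\<lambda>t. block2 (f t) 0 0 0 + block2 0 (g t) 0 0 + block2 0 0 (h t) 0 + block2 0 0 0 (k t))"
    by (intro lip0_add lip0_linear[OF assms(1)] lip0_linear[OF assms(2)] lip0_linear[OF assms(3)]
        lip0_linear[OF assms(4)]) (simp_all add: linear_iff block2_add block2_scaleR)
  then show ?thesis by (simp add: block2_add)
qed

lemma lip0_policy_of:
  fixes A :: "real^'n^'n" and B :: "real^'m^'n" and C :: "real^'n^'p"
  assumes "lip0 L" "lip0 X" "lip0 Y" and N: "invertible N"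
    and G: "pd (F_G (X 0) (Y 0))" "\<forall>\<^sub>F t in at_right 0. pd (F_G (X t) (Y t))"
  shows "lip0 (\<lambda>t. policy_of A B C N (L t) (X t) (Y t))"
proof -
  have blk: "lip0 (\<lambda>t. blk12 (L t))" "lip0 (\<lambda>t. blk21 (L t))" "lip0 (\<lambda>t. blk22 (L t))"
    by (intro lip0_linear[OF assms(1)]; simp add: linear_iff blk_add blk_scaleR)+
  have "lip0 (\<lambda>t. matrix_inv (matrix_inv N ** (mat 1 - Y t ** X t)))"
  proof (rule lip0_matrix_inv)
    show "lip0 (\<lambda>t. matrix_inv N ** (mat 1 - Y t ** X t))"
      by (intro lip0_mult lip0_diff lip0_const assms)
    show "invertible (matrix_inv N ** (mat 1 - Y 0 ** X 0))"
      by (intro invertible_mult invertible_matrix_inv F_G_pd_invertible N G)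
    show "\<forall>\<^sub>F t in at_right 0. invertible (matrix_inv N ** (mat 1 - Y t ** X t))"
      using G(2) by eventually_elim (intro invertible_mult invertible_matrix_inv F_G_pd_invertible N)
  qed
  then show ?thesis
    unfolding policy_of_def Let_def
    by (intro lip0_block2 lip0_mult lip0_diff lip0_const assms blk)
qed

section \<open>Optimal values and stationary points\<close>

lemma L_LQG_D:
  assumes "(K, \<gamma>, P, \<Gamma>) \<in> L_LQG A B C Q R W V"
  shows "K \<in> policy_space" "pd P" "invertible (blk12 P)" "psd \<Gamma>" "trace \<Gamma> \<le> \<gamma>"
    "lyap_lmi (P ** Acl A B C K) (P ** Bcl B W V K) \<gamma>" "out_lmi P (Ccl C Q R K) \<Gamma>"
proof -
  have P: "transpose P = P" using assms by (simp add: L_LQG_def pd_def)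
  have 1: "transpose (Acl A B C K) ** P + P ** Acl A B C K
      = P ** Acl A B C K + transpose (P ** Acl A B C K)"
    and 2: "transpose (Bcl B W V K) ** P = transpose (P ** Bcl B W V K)"
    by (simp_all add: matrix_transpose_mul P add.commute)
  show "K \<in> policy_space" "pd P" "invertible (blk12 P)" "psd \<Gamma>" "trace \<Gamma> \<le> \<gamma>"
    "lyap_lmi (P ** Acl A B C K) (P ** Bcl B W V K) \<gamma>" "out_lmi P (Ccl C Q R K) \<Gamma>"
    using assms unfolding L_LQG_def mem_Collect_eq prod.case 1 2 nsd_block2_iff psd_block2_iff
    by auto
qed

lemma segment_value_less:
  assumes "a < (c::real)"
  obtains t where "0 < t" "t \<le> 1" "(1 - t) * a + t * b < c"
proof (cases "b < c")
  case True
  then show thesis using that[of 1] by simp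
next
  case False
  define D where "D = b - a"
  define t where "t = (c - a) / (2 * D)"
  have D: "0 < D" "c - a \<le> D" using False assms by (auto simp: D_def)
  have "0 < t" "t \<le> 1" using D assms by (auto simp: t_def)
  moreover have "t * D = (c - a) / 2" using D by (simp add: t_def)
  then have "t * (b - a) < c - a" unfolding D_def using assms by simp
  ultimately show thesis using that[of t] by (simp add: algebra_simps)
qed

text \<open>Strict points come arbitrarily close to the value of every stabilizing policy.\<close>

lemma strict_point_below:
  assumes "K \<in> stabilizing A B C" "J_LQG A B C Q R W V K < c"
    and str: "strict_point A B C Q R W V \<gamma>1 \<Lambda>1 X1 Y1 \<Gamma>1"
  obtains \<gamma> \<Lambda> X Y \<Gamma> where "strict_point A B C Q R W V \<gamma> \<Lambda> X Y \<Gamma>" "\<gamma> < c"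
proof -
  obtain \<gamma> where \<gamma>: "J_LQG A B C Q R W V K < \<gamma>" "\<gamma> < c" using dense assms(2) by blast
  have K: "K \<in> policy_space" "hurwitz (Acl A B C K)" using assms(1) by (auto simp: stabilizing_def)
  obtain P \<Gamma> where P: "pd P" "psd \<Gamma>" "trace \<Gamma> \<le> \<gamma>"
    "lyap_lmi (P ** Acl A B C K) (P ** Bcl B W V K) \<gamma>" "out_lmi P (Ccl C Q R K) \<Gamma>"
    using lmi_if_h2_norm_less[OF K(2) \<gamma>(1)[unfolded J_LQG_eq[OF K(1)]]] by blast
  obtain \<Lambda> X Y where r: "relaxed_point A B C Q R W V \<gamma> \<Lambda> X Y \<Gamma>"
    using relaxed_point_of_policy[OF K(1) P] by metis
  obtain t where t: "0 < t" "t \<le> 1" "(1 - t) * \<gamma> + t * \<gamma>1 < c"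
    using segment_value_less[OF \<gamma>(2)] by metis
  have "0 \<le> 1 - t" "1 - t + t = 1" using t by auto
  from strict_point_combine[OF r str this(1) t(1) this(2)] t(3) show thesis by (rule that)
qed

text \<open>A non-degenerate policy \<open>K\<close> corresponds to a point of the convex set with value \<open>J(K)\<close>. If some policy
  were better, one could move from this point along a segment towards a strict point of smaller value.
  The reconstructed policies start at \<open>K\<close>, change at most linearly in \<open>t\<close>, and their cost falls at
  least linearly, so that the gradient at \<open>K\<close> cannot vanish.\<close>

lemma stationary_nondegenerate_optimal:
  fixes A :: "real^'n^'n" and B :: "real^'m^'n" and C :: "real^'n^'p"
  assumes nd: "nondegenerate A B C Q R W V K"
    and grad: "has_gradient_in (J_LQG A B C Q R W V) 0 K policy_space"
    and str: "strict_point A B C Q R W V \<gamma>s \<Lambda>s Xs Ys \<Gamma>s"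
    and K': "K' \<in> stabilizing A B C"
  shows "J_LQG A B C Q R W V K \<le> J_LQG A B C Q R W V K'"
proof (rule ccontr)
  let ?J = "J_LQG A B C Q R W V"
  assume "\<not> ?thesis"
  then have "?J K' < ?J K" by simp
  then obtain \<gamma>1 \<Lambda>1 X1 Y1 \<Gamma>1 where s1: "strict_point A B C Q R W V \<gamma>1 \<Lambda>1 X1 Y1 \<Gamma>1" and less: "\<gamma>1 < ?J K"
    using strict_point_below[OF K' _ str] by metis
  obtain P \<Gamma>0 where "(K, ?J K, P, \<Gamma>0) \<in> L_LQG A B C Q R W V"
    using nd by (auto simp: nondegenerate_def)
  note P = L_LQG_D[OF this]
  define N where "N = blk12 P"
  have N: "invertible N" using P(3) by (simp add: N_def)
  obtain X0 Y0 U where YX: "Y0 ** X0 + N ** U = mat 1"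
    and r0: "relaxed_point A B C Q R W V (?J K) (lift_policy A B C N X0 Y0 U K) X0 Y0 \<Gamma>0"
    and G0: "pd (F_G X0 Y0)"
    using relaxed_point_of_policy[OF P(1,2,4,5,6,7)] P(3) unfolding N_def by metis
  define \<Lambda>0 where "\<Lambda>0 = lift_policy A B C N X0 Y0 U K"
  define L where "L = (\<lambda>t. (1 - t) *\<^sub>R \<Lambda>0 + t *\<^sub>R \<Lambda>1)"
  define X where "X = (\<lambda>t. (1 - t) *\<^sub>R X0 + t *\<^sub>R X1)"
  define Y where "Y = (\<lambda>t. (1 - t) *\<^sub>R Y0 + t *\<^sub>R Y1)"
  define Kt where "Kt = (\<lambda>t. policy_of A B C N (L t) (X t) (Y t))"
  have K0: "Kt 0 = K"
    using policy_of_lift[OF P(1) N G0 YX] by (simp add: Kt_def L_def X_def Y_def \<Lambda>0_def)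
  have st: "strict_point A B C Q R W V ((1 - t) * ?J K + t * \<gamma>1) (L t) (X t) (Y t) ((1 - t) *\<^sub>R \<Gamma>0 + t *\<^sub>R \<Gamma>1)"
    if "0 < t" "t < 1" for t
    unfolding L_def X_def Y_def \<Lambda>0_def using that by (intro strict_point_combine r0 s1) auto
  have "\<forall>\<^sub>F t in at_right 0. pd (F_G (X t) (Y t))"
    using at_right_0_pos at_right_0_less[OF zero_less_one]
    by eventually_elim (use st in \<open>auto simp: strict_point_def\<close>)
  then have "lip0 Kt"
    unfolding Kt_def using G0
    by (intro lip0_policy_of N) (auto simp: L_def X_def Y_def intro: lip0_segment)
  then obtain c where c: "0 \<le> c" "\<forall>\<^sub>F t in at_right 0. norm (Kt t - K) \<le> c * t"
    unfolding lip0_def K0 by blast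
  \<comment> \<open>With vanishing gradient, \<open>J\<close> changes by at most \<open>e c t < t (J(K) - \<gamma>1)\<close> along the curve
    for small \<open>t\<close>.\<close>
  define e where "e = (?J K - \<gamma>1) / (c + 1)"
  have "0 < e" using less c(1) by (simp add: e_def)
  then obtain d where d: "0 < d"
    "\<And>y. y \<in> policy_space \<Longrightarrow> norm (y - K) < d \<Longrightarrow> norm (?J y - ?J K) \<le> e * norm (y - K)"
    using grad unfolding has_gradient_in_def has_derivative_within_alt by auto
  have "0 < d / (c + 1)" using d(1) c(1) by simp
  from eventually_happens[OF eventually_conj[OF c(2) eventually_conj[OF at_right_0_pos
        eventually_conj[OF at_right_0_less[OF zero_less_one] at_right_0_less[OF this]]]]]
  obtain t where t: "norm (Kt t - K) \<le> c * t" "0 < t" "t < 1" "t < d / (c + 1)"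
    by auto
  have "c * t \<le> (c + 1) * t" using t by (simp add: algebra_simps)
  also have "\<dots> < d" using t(4) c(1) by (simp add: field_simps)
  finally have "norm (Kt t - K) < d" using t(1) by simp
  moreover have "Kt t \<in> policy_space" unfolding Kt_def by (rule policy_of_in_policy_space)
  ultimately have "norm (?J (Kt t) - ?J K) \<le> e * norm (Kt t - K)" by (intro d)
  also have "\<dots> \<le> e * (c * t)" using t(1) \<open>0 < e\<close> by simp
  also have "\<dots> < e * ((c + 1) * t)" using t(2) \<open>0 < e\<close> by simp
  also have "\<dots> = t * (?J K - \<gamma>1)" using c(1) by (simp add: e_def)
  finally have "?J K - ?J (Kt t) < t * (?J K - \<gamma>1)" by (simp add: abs_less_iff)
  moreover have "?J (Kt t) \<le> (1 - t) * ?J K + t * \<gamma>1"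
    unfolding Kt_def by (rule strict_point_policy(2)[OF st[OF t(2,3)] N])
  ultimately show False by (simp add: algebra_simps)
qed

text \<open>Both inequalities hold up to an arbitrary \<open>e > 0\<close>, because the reconstruction of a policy applies
  only after mixing with the given strict point.\<close>

lemma INF_J_LQG_eq:
  fixes A :: "real^'n^'n" and B :: "real^'m^'n" and C :: "real^'n^'p"
  assumes str: "strict_point A B C Q R W V \<gamma>s \<Lambda>s Xs Ys \<Gamma>s"
  shows "(INF K\<in>stabilizing A B C. ereal (J_LQG A B C Q R W V K)) =
      (INF (\<gamma>, \<Lambda>, X, Y, \<Gamma>)\<in>F_LQG A B C Q R W V. ereal \<gamma>)" (is "?I = ?F")
proof (rule antisym)
  show "?I \<le> ?F"
  proof (rule INF_greatest, clarify)
    fix \<gamma> \<Lambda> X Y \<Gamma> assume "(\<gamma>, \<Lambda>, X, Y, \<Gamma>) \<in> F_LQG A B C Q R W V"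
    then have r: "relaxed_point A B C Q R W V \<gamma> \<Lambda> X Y \<Gamma>" by (simp add: F_LQG_iff)
    show "?I \<le> ereal \<gamma>"
    proof (rule ereal_le_epsilon2)
      fix e :: real assume "0 < e"
      then obtain t where t: "0 < t" "t \<le> 1" "(1 - t) * \<gamma> + t * \<gamma>s < \<gamma> + e"
        using segment_value_less[of \<gamma> "\<gamma> + e" \<gamma>s] by auto
      have "0 \<le> 1 - t" "1 - t + t = 1" using t by auto
      note s = strict_point_combine[OF r str this(1) t(1) this(2)]
      have inv: "invertible (mat 1 :: real^'n^'n)" by (simp add: invertible_def exI[of _ "mat 1"])
      have "?I \<le> ereal ((1 - t) * \<gamma> + t * \<gamma>s)"
        using strict_point_policy[OF s inv] by (intro INF_lower2) auto
      also have "\<dots> \<le> ereal \<gamma> + ereal e" using t by simp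
      finally show "?I \<le> ereal \<gamma> + ereal e" .
    qed
  qed
  show "?F \<le> ?I"
  proof (rule INF_greatest)
    fix K assume K: "K \<in> stabilizing A B C"
    show "?F \<le> ereal (J_LQG A B C Q R W V K)"
    proof (rule ereal_le_epsilon2)
      fix e :: real assume "0 < e"
      then have "J_LQG A B C Q R W V K < J_LQG A B C Q R W V K + e" by simp
      then obtain \<gamma> \<Lambda> X Y \<Gamma> where s: "strict_point A B C Q R W V \<gamma> \<Lambda> X Y \<Gamma>" "\<gamma> < J_LQG A B C Q R W V K + e"
        using strict_point_below[OF K _ str] by blast
      then have "(\<gamma>, \<Lambda>, X, Y, \<Gamma>) \<in> F_LQG A B C Q R W V"
        by (simp add: F_LQG_iff strict_point_def)
      then have "?F \<le> ereal \<gamma>" by (intro INF_lower2) auto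
      also have "\<dots> \<le> ereal (J_LQG A B C Q R W V K) + ereal e" using s(2) by simp
      finally show "?F \<le> ereal (J_LQG A B C Q R W V K) + ereal e" .
    qed
  qed
qed

theorem corollary4p2:
  fixes A :: "real^'n^'n" and B :: "real^'m^'n" and C :: "real^'n^'p"
    and Q W :: "real^'n^'n" and R :: "real^'m^'m" and V :: "real^'p^'p"
  assumes "psd Q" and "pd R" and "psd W" and "pd V"
    and "controllable A (matrix_sqrt W)" and "controllable A B"
    and "observable (matrix_sqrt Q) A" and "observable C A"
  shows "convex (F_LQG A B C Q R W V) \<and>
    (INF K\<in>stabilizing A B C. ereal (J_LQG A B C Q R W V K)) =
      (INF (\<gamma>, \<Lambda>, X, Y, \<Gamma>)\<in>F_LQG A B C Q R W V. ereal \<gamma>) \<and>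
    (\<forall>K\<in>stabilizing A B C.
       nondegenerate A B C Q R W V K \<and>
       has_gradient_in (J_LQG A B C Q R W V) 0 K policy_space \<longrightarrow>
       (\<forall>K'\<in>stabilizing A B C. J_LQG A B C Q R W V K \<le> J_LQG A B C Q R W V K'))"
proof -
  obtain \<gamma> \<Lambda> X Y \<Gamma> where str: "strict_point A B C Q R W V \<gamma> \<Lambda> X Y \<Gamma>"
    using strict_point_exists[OF assms(6,8)] by metis
  show ?thesis
    using convex_F_LQG INF_J_LQG_eq[OF str] stationary_nondegenerate_optimal[OF _ _ str] by blast
qed

end
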